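(* Let $k\ge 2$ and let $\mathbb{F}$ be an algebraically closed field whose characteristic is $0$ or at least $k+1$. Let $X$ be the asymptotic spectrum of $k$-tensors over $\mathbb{F}$ and let $X_{\mathrm{s}}$ be the asymptotic spectrum of symmetric $k$-tensors over $\mathbb{F}$. Then the restriction map $r:X\to X_{\mathrm{s}}$, which maps $\phi\in X$ to the restriction of $\phi$ to symmetric tensors, is surjective.
   Context: A $k$-tensor over $\mathbb{F}$ is an element of $\mathbb{F}^{d_1}\otimes\cdots\otimes\mathbb{F}^{d_k}$ for some $d_1,\dots,d_k$; a symmetric $k$-tensor is an element of $(\mathbb{F}^d)^{\otimes k}$ for some $d$ whose coordinates are invariant under all permutations of the $k$ indices. For $f\in\mathbb{F}^{d_1}\otimes\cdots\otimes\mathbb{F}^{d_k}$ and $g\in\mathbb{F}^{e_1}\otimes\cdots\otimes\mathbb{F}^{e_k}$, the direct sum $f\oplus g$ is the corresponding block-diagonal $k$-tensor in $(\mathbb{F}^{d_1}\oplus\mathbb{F}^{e_1})\otimes\cdots\otimes(\mathbb{F}^{d_k}\oplus\mathbb{F}^{e_k})$, and the tensor product $f\otimes g$ is regarded as a $k$-tensor in $(\mathbb{F}^{d_1}\otimes\mathbb{F}^{e_1})\otimes\cdots\otimes(\mathbb{F}^{d_k}\otimes\mathbb{F}^{e_k})$. Write $g\le f$ (restriction) if $g=(A^{(1)}\otimes\cdots\otimes A^{(k)})f$ for some linear maps $A^{(i)}:\mathbb{F}^{d_i}\to\mathbb{F}^{e_i}$. For $f\in(\mathbb{F}^d)^{\otimes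 k}$ and $g\in(\mathbb{F}^e)^{\otimes k}$ write $g\le_{\mathrm{s}} f$ (symmetric restriction) if $g=A^{\otimes k}f$ for some linear map $A:\mathbb{F}^d\to\mathbb{F}^e$. Let $\langle 1\rangle=e_1^{\otimes k}\in(\mathbb{F}^1)^{\otimes k}$. The asymptotic spectrum of tensors $X$ is the set of all maps $\phi$ from $k$-tensors over $\mathbb{F}$ to the nonnegative reals with $\phi(f\oplus g)=\phi(f)+\phi(g)$, $\phi(f\otimes g)=\phi(f)\phi(g)$, $\phi(\langle1\rangle)=1$, and $g\le f\Rightarrow\phi(g)\le\phi(f)$. The asymptotic spectrum of symmetric tensors $X_{\mathrm{s}}$ is the set of all maps $\phi$ from symmetric $k$-tensors over $\mathbb{F}$ to the nonnegative reals with $\phi(f\oplus g)=\phi(f)+\phi(g)$, $\phi(f\otimes g)=\phi(f)\phi(g)$, $\phi(\langle1\rangle)=1$, and $g\le_{\mathrm{s}} f\Rightarrow\phi(g)\le\phi(f)$. *)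

theory Defs
  imports "HOL-Combinatorics.Permutations" "HOL-Library.FuncSet"
    "HOL-Computational_Algebra.Polynomial" "Jordan_Normal_Form.Matrix"
begin

definition indices :: "nat list \<Rightarrow> nat list set" where
  "indices ds = {is. list_all2 (<) is ds}"

lemma finite_indices: "finite (indices ds)"
proof (induction ds)
  case Nil
  then show ?case by (simp add: indices_def)
next
  case (Cons d ds)
  have "indices (d # ds) = (\<lambda>(i, is). i # is) ` ({..<d} \<times> indices ds)"
    by (auto simp: indices_def list_all2_Cons2)
  then show ?case using Cons by simp
qed

text \<open>
  A tensor with dimensions \<open>[d\<^sub>1, \<dots>, d\<^sub>k]\<close> is the array of its coordinates in the standard
  bases (0-based). Coordinates outside the index range carry no information
  (they are \<^const>\<open>undefined\<close>), so equality of tensors is equality of the dimensions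
  and of all coordinates.
\<close>

typedef 'a tensor = "{(ds, f :: nat list \<Rightarrow> 'a). f \<in> extensional (indices ds)}"
  by (rule exI[of _ "([], \<lambda>is\<in>indices []. undefined)"]) simp

definition tensor :: "nat list \<Rightarrow> (nat list \<Rightarrow> 'a) \<Rightarrow> 'a tensor" where
  "tensor ds f = Abs_tensor (ds, restrict f (indices ds))"

definition dims :: "'a tensor \<Rightarrow> nat list" where
  "dims t = fst (Rep_tensor t)"

definition entry :: "'a tensor \<Rightarrow> nat list \<Rightarrow> 'a" where
  "entry t = snd (Rep_tensor t)"

lemma dims_tensor [simp]: "dims (tensor ds f) = ds"
  by (simp add: dims_def tensor_def Abs_tensor_inverse)

lemma entry_tensor [simp]: "is \<in> indices ds \<Longrightarrow> entry (tensor ds f) is = f is"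
  by (simp add: entry_def tensor_def Abs_tensor_inverse)

lemma entry_extensional: "entry t \<in> extensional (indices (dims t))"
  using Rep_tensor[of t] by (auto simp: entry_def dims_def)

lemma tensor_eqI:
  assumes "dims s = dims t" and "\<And>is. is \<in> indices (dims t) \<Longrightarrow> entry s is = entry t is"
  shows "s = t"
proof -
  have "entry s = entry t"
    using assms entry_extensional[of s] entry_extensional[of t] by (auto intro: extensionalityI)
  then have "Rep_tensor s = Rep_tensor t"
    using assms(1) by (simp add: prod_eq_iff dims_def entry_def)
  then show ?thesis by (simp add: Rep_tensor_inject)
qed

definition tensors :: "nat \<Rightarrow> 'a tensor set" where
  "tensors k = {t. length (dims t) = k}"

definition sym_tensors :: "nat \<Rightarrow> 'a tensor set" where
  "sym_tensors k = {t. (\<exists>d. dims t = replicate k d) \<and>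
     (\<forall>p. p permutes {..<k} \<longrightarrow>
        (\<forall>is\<in>indices (dims t). entry t (permute_list p is) = entry t is))}"

text \<open>
  The block-diagonal tensor: in every factor, the basis of \<open>F\<^sup>d \<oplus> F\<^sup>e\<close> is the basis of \<open>F\<^sup>d\<close>
  followed by that of \<open>F\<^sup>e\<close>.
\<close>

definition tensor_sum :: "'a::zero tensor \<Rightarrow> 'a tensor \<Rightarrow> 'a tensor" where
  "tensor_sum f g = tensor (map2 (+) (dims f) (dims g))
     (\<lambda>is. if list_all2 (<) is (dims f) then entry f is
           else if list_all2 (\<ge>) is (dims f) then entry g (map2 (-) is (dims f))
           else 0)"

text \<open>
  In every factor, the basis vector \<open>e\<^sub>i \<otimes> e\<^sub>j\<close> of \<open>F\<^sup>d \<otimes> F\<^sup>e\<close> is the basis vector with number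
  \<open>i * e + j\<close> of \<open>F\<^sup>d\<^sup>e\<close>.
\<close>

definition tensor_prod :: "'a::times tensor \<Rightarrow> 'a tensor \<Rightarrow> 'a tensor" where
  "tensor_prod f g = tensor (map2 (*) (dims f) (dims g))
     (\<lambda>is. entry f (map2 (div) is (dims g)) * entry g (map2 (mod) is (dims g)))"

text \<open>\<open>(A\<^sub>1 \<otimes> \<dots> \<otimes> A\<^sub>k) f\<close>, meaningful if the numbers of columns of the matrices are \<open>dims f\<close>.\<close>

definition tensor_apply :: "'a::comm_semiring_1 mat list \<Rightarrow> 'a tensor \<Rightarrow> 'a tensor" where
  "tensor_apply As f = tensor (map dim_row As)
     (\<lambda>is. \<Sum>js\<in>indices (dims f). (\<Prod>l<length As. (As ! l) $$ (is ! l, js ! l)) * entry f js)"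

definition restricts :: "'a::comm_semiring_1 tensor \<Rightarrow> 'a tensor \<Rightarrow> bool" where
  "restricts g f \<longleftrightarrow> (\<exists>As. map dim_col As = dims f \<and> g = tensor_apply As f)"

definition sym_restricts :: "'a::comm_semiring_1 tensor \<Rightarrow> 'a tensor \<Rightarrow> bool" where
  "sym_restricts g f \<longleftrightarrow>
     (\<exists>A. let As = replicate (length (dims f)) A in map dim_col As = dims f \<and> g = tensor_apply As f)"

definition unit_tensor :: "nat \<Rightarrow> 'a::one tensor" where
  "unit_tensor k = tensor (replicate k 1) (\<lambda>_. 1)"

text \<open>
  Maps defined on a set of tensors are extensional functions, so that two elements of a
  spectrum are equal as soon as they agree on that set.
\<close>

definition asymptotic_spectrum :: "nat \<Rightarrow> ('a::comm_semiring_1 tensor \<Rightarrow> real) set" where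
  "asymptotic_spectrum k = {\<phi> \<in> tensors k \<rightarrow>\<^sub>E {0..}.
     (\<forall>f\<in>tensors k. \<forall>g\<in>tensors k. \<phi> (tensor_sum f g) = \<phi> f + \<phi> g) \<and>
     (\<forall>f\<in>tensors k. \<forall>g\<in>tensors k. \<phi> (tensor_prod f g) = \<phi> f * \<phi> g) \<and>
     \<phi> (unit_tensor k) = 1 \<and>
     (\<forall>f\<in>tensors k. \<forall>g\<in>tensors k. restricts g f \<longrightarrow> \<phi> g \<le> \<phi> f)}"

definition sym_asymptotic_spectrum :: "nat \<Rightarrow> ('a::comm_semiring_1 tensor \<Rightarrow> real) set" where
  "sym_asymptotic_spectrum k = {\<phi> \<in> sym_tensors k \<rightarrow>\<^sub>E {0..}.
     (\<forall>f\<in>sym_tensors k. \<forall>g\<in>sym_tensors k. \<phi> (tensor_sum f g) = \<phi> f + \<phi> g) \<and>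
     (\<forall>f\<in>sym_tensors k. \<forall>g\<in>sym_tensors k. \<phi> (tensor_prod f g) = \<phi> f * \<phi> g) \<and>
     \<phi> (unit_tensor k) = 1 \<and>
     (\<forall>f\<in>sym_tensors k. \<forall>g\<in>sym_tensors k. sym_restricts g f \<longrightarrow> \<phi> g \<le> \<phi> f)}"

end

theory Submission
  imports Defs
begin

text \<open>
  A point \<open>\<phi>\<close> of the symmetric spectrum is monotone even under ordinary restriction: if \<open>f \<le> g\<close> are
  symmetric, then averaging over the symmetric group, which needs \<open>k!\<close> to be invertible, gives
  \<open>f \<le>\<^sub>s h \<otimes> g\<close> for a symmetric tensor \<open>h\<close> depending only on \<open>k\<close>. Applied to tensor powers this yields
  \<open>\<phi> f ^ n \<le> \<phi> h * \<phi> g ^ n\<close> for all \<open>n\<close>, hence \<open>\<phi> f \<le> \<phi> g\<close>.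

  It remains to extend a monotone homomorphism \<open>\<phi>\<close> from a subsemiring to a preordered semiring in
  which every element lies between 0 and a natural number. By Zorn's lemma the preorder can be
  enlarged to one that is maximal among those for which \<open>\<phi>\<close> stays monotone. A maximal preorder
  is cancellative, agrees with the order of the reals on the subsemiring, and is total: if neither
  \<open>a \<le> b\<close> nor \<open>b \<le> a\<close>, then \<open>1 + t a \<le> t b\<close> and \<open>1 + t' b \<le> t' a\<close> for some \<open>t\<close>, \<open>t'\<close>, whence
  \<open>t + t' \<le> 0\<close>, which is absurd. The extension of \<open>\<phi>\<close> sends \<open>x\<close> to the infimum of the fractions
  \<open>p / q\<close> with \<open>q x \<le> p\<close>.
\<close>

section \<open>Extending points of preordered semirings\<close>

text \<open>The obstacle to enlarging the preorder is that an inequality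
  \<open>u + t * s \<sqsubseteq> v + t * s'\<close> produced by a new relation may involve a
  multiplier \<open>t\<close> outside the subsemiring, where \<open>\<phi>\<close> has no meaning.
  Multiplying by a geometric sum in \<open>s\<close> and \<open>s'\<close> makes the multiples of
  \<open>t\<close> telescope until only \<open>t * s ^ n\<close> and \<open>t * s' ^ n\<close>
  survive. The first is dropped, the second is bounded through a natural number above
  \<open>t\<close>, and it becomes negligible as n grows. So a relation \<open>s' \<le> s\<close>
  within the subsemiring may be adjoined as soon as \<open>\<phi> s' \<le> \<phi> s\<close>.

  The inequality \<open>1 + t a \<le> t b\<close> records why \<open>b \<le> a\<close> could not be
  adjoined: some \<open>u\<close>, \<open>v\<close> of the subsemiring with
  \<open>\<phi> v < \<phi> u\<close> would be put in the wrong order, and a multiple turns their gap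
  into a summand 1.

  A symmetric restriction has one linear map where a restriction has k of them. The tensor h
  compensates by supplying labels: the label found in a factor tells the single map which of the k
  maps to imitate there.\<close>

locale semiring_preorder =
  fixes le :: "'b::comm_semiring_1 \<Rightarrow> 'b \<Rightarrow> bool" (infix "\<sqsubseteq>" 50)
  assumes le_refl: "x \<sqsubseteq> x"
    and le_trans: "x \<sqsubseteq> y \<Longrightarrow> y \<sqsubseteq> z \<Longrightarrow> x \<sqsubseteq> z"
    and le_add: "x \<sqsubseteq> y \<Longrightarrow> x + z \<sqsubseteq> y + z"
    and le_mult: "x \<sqsubseteq> y \<Longrightarrow> x * z \<sqsubseteq> y * z"
    and zero_le: "0 \<sqsubseteq> x"
    and le_of_nat: "\<exists>n. x \<sqsubseteq> of_nat n"
begin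

lemma le_add_mono: "x \<sqsubseteq> y \<Longrightarrow> z \<sqsubseteq> w \<Longrightarrow> x + z \<sqsubseteq> y + w"
  using le_add[of x y z] le_add[of z w y] le_trans by (simp add: add.commute)

lemma le_mult_mono: "x \<sqsubseteq> y \<Longrightarrow> z \<sqsubseteq> w \<Longrightarrow> x * z \<sqsubseteq> y * w"
  using le_mult[of x y z] le_mult[of z w y] le_trans by (simp add: mult.commute)

lemma le_mult_left: "x \<sqsubseteq> y \<Longrightarrow> z * x \<sqsubseteq> z * y"
  using le_mult[of x y z] by (simp add: mult.commute)

lemma le_addI: "x \<sqsubseteq> x + y"
  using le_add_mono[OF le_refl zero_le, of x y] by simp

text \<open>The preorder obtained by adjoining the relation \<open>s' \<le> s\<close>; for \<open>s = s' = 1\<close> it is the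
  cancellative closure.\<close>

definition adjoin :: "'b \<Rightarrow> 'b \<Rightarrow> 'b \<Rightarrow> 'b \<Rightarrow> bool" where
  "adjoin s s' x y \<longleftrightarrow> (\<exists>t. x + t * s \<sqsubseteq> y + t * s')"

lemma adjoin_extends: "x \<sqsubseteq> y \<Longrightarrow> adjoin s s' x y"
  unfolding adjoin_def by (rule exI[of _ 0]) simp

lemma adjoin_adjoined: "adjoin s s' s' s"
  unfolding adjoin_def by (rule exI[of _ 1]) (simp add: add.commute le_refl)

lemma semiring_preorder_adjoin: "semiring_preorder (adjoin s s')"
proof
  show "adjoin s s' x x" for x
    by (simp add: adjoin_extends le_refl)
  show "adjoin s s' x z" if "adjoin s s' x y" "adjoin s s' y z" for x y z
  proof -
    from that obtain t u where t: "x + t * s \<sqsubseteq> y + t * s'" and u: "y + u * s \<sqsubseteq> z + u * s'"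
      by (auto simp: adjoin_def)
    have "(x + t * s) + u * s \<sqsubseteq> (y + t * s') + u * s"
      using t by (rule le_add)
    also have "(y + t * s') + u * s = (y + u * s) + t * s'"
      by (simp add: algebra_simps)
    finally have "(x + t * s) + u * s \<sqsubseteq> (z + u * s') + t * s'"
      using le_trans le_add[OF u] by blast
    then have "x + (t + u) * s \<sqsubseteq> z + (t + u) * s'"
      by (simp add: algebra_simps)
    then show ?thesis unfolding adjoin_def by blast
  qed
  show "adjoin s s' (x + z) (y + z)" if "adjoin s s' x y" for x y z
  proof -
    from that obtain t where "x + t * s \<sqsubseteq> y + t * s'" by (auto simp: adjoin_def)
    from le_add[OF this, of z] have "(x + z) + t * s \<sqsubseteq> (y + z) + t * s'"
      by (simp add: algebra_simps)
    then show ?thesis unfolding adjoin_def by blast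
  qed
  show "adjoin s s' (x * z) (y * z)" if "adjoin s s' x y" for x y z
  proof -
    from that obtain t where "x + t * s \<sqsubseteq> y + t * s'" by (auto simp: adjoin_def)
    from le_mult[OF this, of z] have "x * z + (t * z) * s \<sqsubseteq> y * z + (t * z) * s'"
      by (simp add: algebra_simps)
    then show ?thesis unfolding adjoin_def by blast
  qed
  show "adjoin s s' 0 x" for x
    by (simp add: adjoin_extends zero_le)
  show "\<exists>n. adjoin s s' x (of_nat n)" for x
    using le_of_nat adjoin_extends by blast
qed

end

section \<open>Points on a subsemiring and the adjunction of a relation\<close>

locale subsemiring_point = semiring_preorder le
  for le :: "'b::comm_semiring_1 \<Rightarrow> 'b \<Rightarrow> bool" (infix "\<sqsubseteq>" 50) +
  fixes S :: "'b set" and \<phi> :: "'b \<Rightarrow> real"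
  assumes zero_S: "0 \<in> S" and one_S: "1 \<in> S"
    and add_S: "x \<in> S \<Longrightarrow> y \<in> S \<Longrightarrow> x + y \<in> S"
    and mult_S: "x \<in> S \<Longrightarrow> y \<in> S \<Longrightarrow> x * y \<in> S"
    and \<phi>_add: "x \<in> S \<Longrightarrow> y \<in> S \<Longrightarrow> \<phi> (x + y) = \<phi> x + \<phi> y"
    and \<phi>_mult: "x \<in> S \<Longrightarrow> y \<in> S \<Longrightarrow> \<phi> (x * y) = \<phi> x * \<phi> y"
    and \<phi>_one: "\<phi> 1 = 1"
    and \<phi>_mono: "x \<in> S \<Longrightarrow> y \<in> S \<Longrightarrow> x \<sqsubseteq> y \<Longrightarrow> \<phi> x \<le> \<phi> y"
begin

lemma of_nat_S: "of_nat n \<in> S"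
  by (induction n) (auto simp: zero_S one_S add_S)

lemma power_S: "x \<in> S \<Longrightarrow> x ^ n \<in> S"
  by (induction n) (auto simp: one_S mult_S)

lemma \<phi>_zero: "\<phi> 0 = 0"
  using \<phi>_add[OF zero_S zero_S] by simp

lemma \<phi>_of_nat: "\<phi> (of_nat n) = real n"
  by (induction n) (auto simp: \<phi>_zero \<phi>_add one_S of_nat_S \<phi>_one)

lemma \<phi>_nonneg: "x \<in> S \<Longrightarrow> 0 \<le> \<phi> x"
  using \<phi>_mono[OF zero_S _ zero_le] by (simp add: \<phi>_zero)

lemma \<phi>_power: "x \<in> S \<Longrightarrow> \<phi> (x ^ n) = \<phi> x ^ n"
  by (induction n) (auto simp: \<phi>_one \<phi>_mult power_S)

text \<open>After telescoping, the foreign element \<open>t\<close> contributes at most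
  \<open>real N * \<phi> s' ^ n\<close>, while \<open>\<phi> (H n)\<close> is at least
  \<open>n * \<phi> s' ^ (n - 1)\<close>. A positive difference \<open>\<phi> u - \<phi> v\<close>
  would thus be at most a constant divided by n, for every n.\<close>

lemma \<phi>_mono_adjoin:
  assumes S: "s \<in> S" "s' \<in> S" "u \<in> S" "v \<in> S"
    and le: "\<phi> s' \<le> \<phi> s" and uv: "adjoin s s' u v"
  shows "\<phi> u \<le> \<phi> v"
proof -
  obtain t where t: "u + t * s \<sqsubseteq> v + t * s'" using uv by (auto simp: adjoin_def)
  obtain N where N: "t \<sqsubseteq> of_nat N" using le_of_nat by blast
  \<comment> \<open>\<open>H n\<close> is the sum of \<open>s ^ i * s' ^ j\<close> over
    \<open>i + j + 1 = n\<close>, written as a recursion free of subtraction.\<close>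
  define H where "H = rec_nat 0 (\<lambda>n h. s' * h + s ^ n)"
  have H_0: "H 0 = 0" and H_Suc: "H (Suc n) = s' * H n + s ^ n" for n
    by (simp_all add: H_def)
  have H_S: "H n \<in> S" for n
    by (induction n) (auto simp: H_0 H_Suc zero_S add_S mult_S power_S S)
  \<comment> \<open>Each of the \<open>Suc n\<close> summands has value at least
    \<open>\<phi> s' ^ n\<close>, since \<open>\<phi> s' \<le> \<phi> s\<close>.\<close>
  have H_ge: "\<phi> (H (Suc n)) \<ge> real (Suc n) * \<phi> s' ^ n" for n
  proof (induction n)
    case 0
    then show ?case
      by (simp add: H_0 H_Suc \<phi>_one)
  next
    case (Suc n)
    have "real (Suc (Suc n)) * \<phi> s' ^ Suc n = \<phi> s' * (real (Suc n) * \<phi> s' ^ n) + \<phi> s' ^ Suc n"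
      by (simp add: algebra_simps)
    also have "\<dots> \<le> \<phi> s' * \<phi> (H (Suc n)) + \<phi> s ^ Suc n"
      using Suc le \<phi>_nonneg[OF S(2)]
      by (intro add_mono mult_left_mono power_mono) auto
    also have "\<dots> = \<phi> (H (Suc (Suc n)))"
      using S by (subst H_Suc) (simp add: \<phi>_add \<phi>_mult \<phi>_power H_S power_S mult_S del: power_Suc)
    finally show ?case .
  qed
  \<comment> \<open>In a ring \<open>(s - s') * H n = s\<^sup>n - s'\<^sup>n\<close>, so this is the hypothesis multiplied by \<open>H n\<close>.\<close>
  have key: "u * H n + t * s ^ n \<sqsubseteq> v * H n + t * s' ^ n" for n
  proof (induction n)
    case 0
    then show ?case by (simp add: H_0 le_refl)
  next
    case (Suc n)
    have "u * H (Suc n) + t * s ^ Suc n = s' * u * H n + s ^ n * (u + t * s)"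
      by (simp add: H_Suc algebra_simps)
    also have "s' * u * H n + s ^ n * (u + t * s) \<sqsubseteq> s' * u * H n + s ^ n * (v + t * s')"
      by (intro le_add_mono le_refl le_mult_left t)
    finally have 1: "u * H (Suc n) + t * s ^ Suc n \<sqsubseteq> s' * u * H n + s ^ n * (v + t * s')" .
    have "s' * u * H n + s ^ n * (v + t * s') = v * s ^ n + s' * (u * H n + t * s ^ n)"
      by (simp add: algebra_simps)
    also have "v * s ^ n + s' * (u * H n + t * s ^ n) \<sqsubseteq> v * s ^ n + s' * (v * H n + t * s' ^ n)"
      by (intro le_add_mono le_refl le_mult_left Suc)
    also have "v * s ^ n + s' * (v * H n + t * s' ^ n) = v * H (Suc n) + t * s' ^ Suc n"
      by (simp add: H_Suc algebra_simps)
    finally show ?case using 1 le_trans by blast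
  qed
  have bound: "\<phi> u * \<phi> (H n) \<le> \<phi> v * \<phi> (H n) + real N * \<phi> s' ^ n" for n
  proof -
    \<comment> \<open>The term \<open>t * s ^ n\<close> is dropped and the other \<open>t\<close> is
      replaced by its bound \<open>N\<close>; all that remains lies in \<open>S\<close>, so
      \<open>\<phi>\<close> applies.\<close>
    have "u * H n \<sqsubseteq> v * H n + of_nat N * s' ^ n"
      using le_trans[OF le_addI key] le_trans le_add_mono[OF le_refl le_mult[OF N]] by blast
    then have "\<phi> (u * H n) \<le> \<phi> (v * H n + of_nat N * s' ^ n)"
      using S by (intro \<phi>_mono) (auto intro: add_S mult_S power_S H_S of_nat_S)
    then show ?thesis
      using S by (simp add: \<phi>_add \<phi>_mult \<phi>_power \<phi>_of_nat H_S of_nat_S power_S mult_S)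
  qed
  show ?thesis
  proof (rule ccontr)
    assume "\<not> ?thesis"
    then have d: "\<phi> u - \<phi> v > 0" by simp
    have *: "(\<phi> u - \<phi> v) * (real (Suc n) * \<phi> s' ^ n) \<le> real N * \<phi> s' * \<phi> s' ^ n" for n
    proof -
      have "(\<phi> u - \<phi> v) * (real (Suc n) * \<phi> s' ^ n) \<le> (\<phi> u - \<phi> v) * \<phi> (H (Suc n))"
        using d H_ge by (intro mult_left_mono) auto
      also have "\<dots> \<le> real N * \<phi> s' ^ Suc n"
        using bound[of "Suc n"] by (simp add: algebra_simps)
      finally show ?thesis by simp
    qed
    show False
    proof (cases "\<phi> s' = 0")
      case True
      \<comment> \<open>As \<open>0 ^ 0 = 1\<close>, the instance \<open>n = 0\<close> bounds
        \<open>\<phi> u - \<phi> v\<close> by 0.\<close>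
      then show False using *[of 0] d by simp
    next
      case False
      then have pos: "\<phi> s' > 0" using \<phi>_nonneg[OF S(2)] by simp
      obtain n where n: "real n * (\<phi> u - \<phi> v) > real N * \<phi> s'"
        using reals_Archimedean3[OF d] by blast
      have "((\<phi> u - \<phi> v) * real (Suc n)) * \<phi> s' ^ n \<le> (real N * \<phi> s') * \<phi> s' ^ n"
        using *[of n] by (simp add: mult.assoc)
      then have "(\<phi> u - \<phi> v) * real (Suc n) \<le> real N * \<phi> s'"
        using pos by (simp del: of_nat_Suc)
      then show False using n d by (simp add: algebra_simps)
    qed
  qed
qed

lemma subsemiring_point_adjoin:
  assumes "s \<in> S" "s' \<in> S" "\<phi> s' \<le> \<phi> s"
  shows "subsemiring_point (adjoin s s') S \<phi>"
proof -
  interpret adj: semiring_preorder "adjoin s s'" by (rule semiring_preorder_adjoin)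
  show ?thesis
    using assms
    by unfold_locales
       (auto simp: zero_S one_S add_S mult_S \<phi>_add \<phi>_mult \<phi>_one intro: \<phi>_mono_adjoin)
qed

end

section \<open>Maximal preorders: cancellation and totality\<close>

locale maximal_subsemiring_point = subsemiring_point +
  assumes maximal: "subsemiring_point le' S \<phi> \<Longrightarrow> (\<And>x y. x \<sqsubseteq> y \<Longrightarrow> le' x y) \<Longrightarrow> le' x y \<Longrightarrow> x \<sqsubseteq> y"
begin

lemma le_iff_\<phi>_le:
  assumes "s \<in> S" "s' \<in> S"
  shows "s' \<sqsubseteq> s \<longleftrightarrow> \<phi> s' \<le> \<phi> s"
proof
  show "\<phi> s' \<le> \<phi> s" if "s' \<sqsubseteq> s"
    using that assms by (intro \<phi>_mono)
  show "s' \<sqsubseteq> s" if "\<phi> s' \<le> \<phi> s"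
    by (rule maximal[OF subsemiring_point_adjoin[OF assms that]])
       (simp_all add: adjoin_extends adjoin_adjoined)
qed

text \<open>Adjoining the trivial relation \<open>1 \<sqsubseteq> 1\<close> gives nothing new for a
  maximal preorder, and the multiplier in \<open>adjoin 1 1\<close> is precisely a summand that may
  be cancelled.\<close>

lemma le_cancel:
  assumes "x + z \<sqsubseteq> y + z"
  shows "x \<sqsubseteq> y"
proof (rule maximal[OF subsemiring_point_adjoin[OF one_S one_S order_refl]])
  show "adjoin 1 1 x y"
    unfolding adjoin_def using assms by (intro exI[of _ z]) simp
qed (rule adjoin_extends)

text \<open>By maximality, adjoining \<open>b \<sqsubseteq> a\<close> must spoil something. The
  preorder axioms survive, so it is the monotonicity of \<open>\<phi>\<close> that fails, and the
  pair at which it fails provides the unit by which \<open>t * b\<close> exceeds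
  \<open>t * a\<close>.\<close>

lemma adjoin_strict:
  assumes "\<not> b \<sqsubseteq> a"
  obtains t where "1 + t * a \<sqsubseteq> t * b"
proof -
  have "\<not> subsemiring_point (adjoin a b) S \<phi>"
  proof
    assume "subsemiring_point (adjoin a b) S \<phi>"
    then have "b \<sqsubseteq> a"
      by (rule maximal) (simp_all add: adjoin_extends adjoin_adjoined)
    then show False using assms by simp
  qed
  moreover have "subsemiring_point (adjoin a b) S \<phi>"
    if "\<And>u v. u \<in> S \<Longrightarrow> v \<in> S \<Longrightarrow> adjoin a b u v \<Longrightarrow> \<phi> u \<le> \<phi> v"
  proof -
    interpret adj: semiring_preorder "adjoin a b" by (rule semiring_preorder_adjoin)
    show ?thesis
      using that
      by unfold_locales (auto simp: zero_S one_S add_S mult_S \<phi>_add \<phi>_mult \<phi>_one)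
  qed
  ultimately obtain u v t where uv: "u \<in> S" "v \<in> S" "u + t * a \<sqsubseteq> v + t * b" "\<phi> v < \<phi> u"
    unfolding adjoin_def by (meson not_le)
  \<comment> \<open>A multiple widens the gap between \<open>\<phi> u\<close> and
    \<open>\<phi> v\<close> beyond 1; on \<open>S\<close> the preorder agrees with the order of the
    reals, so the gap can be stated inside the semiring.\<close>
  obtain n where n: "real n * (\<phi> u - \<phi> v) > 1"
    using reals_Archimedean3[of "\<phi> u - \<phi> v"] uv(4) by auto
  have "of_nat n * v + 1 \<sqsubseteq> of_nat n * u"
    using uv n by (subst le_iff_\<phi>_le)
      (auto simp: \<phi>_add \<phi>_mult \<phi>_one \<phi>_of_nat mult_S add_S one_S of_nat_S algebra_simps)
  then have "(of_nat n * v + 1) + of_nat n * (t * a) \<sqsubseteq> of_nat n * u + of_nat n * (t * a)"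
    by (rule le_add)
  moreover have "of_nat n * u + of_nat n * (t * a) \<sqsubseteq> of_nat n * v + of_nat n * (t * b)"
    using le_mult_left[OF uv(3), of "of_nat n"] by (simp add: algebra_simps)
  ultimately have "(of_nat n * v + 1) + of_nat n * (t * a) \<sqsubseteq> of_nat n * v + of_nat n * (t * b)"
    using le_trans by blast
  then have "(1 + of_nat n * t * a) + of_nat n * v \<sqsubseteq> of_nat n * t * b + of_nat n * v"
    by (simp add: algebra_simps)
  then show thesis using le_cancel that by blast
qed

lemma le_total: "a \<sqsubseteq> b \<or> b \<sqsubseteq> a"
proof (rule ccontr)
  assume *: "\<not> ?thesis"
  then obtain t t' where t: "1 + t * a \<sqsubseteq> t * b" and t': "1 + t' * b \<sqsubseteq> t' * a"
    using adjoin_strict by metis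
  \<comment> \<open>With these multipliers both sides contain \<open>t * t' * a\<close> and
    \<open>t * t' * b\<close>, which cancel.\<close>
  have "t' * (1 + t * a) + t * (1 + t' * b) \<sqsubseteq> t' * (t * b) + t * (t' * a)"
    using t t' by (intro le_add_mono le_mult_left)
  then have "(t + t') + (t * t' * a + t * t' * b) \<sqsubseteq> 0 + (t * t' * a + t * t' * b)"
    by (simp add: algebra_simps)
  then have "t + t' \<sqsubseteq> 0" by (rule le_cancel)
  \<comment> \<open>A multiplier below 0 is contradictory only in combination with its own
    inequality: it puts \<open>t * b\<close> below 0, and
    \<open>1 + t * a \<sqsubseteq> t * b\<close> then puts 1 below 0.\<close>
  then have t0: "t \<sqsubseteq> 0" using le_addI le_trans by blast
  have "1 \<sqsubseteq> 1 + t * a" by (rule le_addI)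
  moreover have "t * b \<sqsubseteq> 0" using le_mult[OF t0, of b] by simp
  ultimately have "1 \<sqsubseteq> 0" using t le_trans by blast
  then show False
    using \<phi>_mono[OF one_S zero_S] by (simp add: \<phi>_one \<phi>_zero)
qed

section \<open>Real values of elements, defined by cuts\<close>

lemma of_nat_preorder_iff: "of_nat m \<sqsubseteq> of_nat n \<longleftrightarrow> m \<le> n"
  by (simp add: le_iff_\<phi>_le of_nat_S \<phi>_of_nat)

definition cut :: "'a \<Rightarrow> real" where
  "cut t = Inf {real p / real q | p q. q > 0 \<and> of_nat q * t \<sqsubseteq> of_nat p}"

lemma cut_le:
  assumes "q > 0" "of_nat q * t \<sqsubseteq> of_nat p"
  shows "cut t \<le> real p / real q"
  unfolding cut_def by (rule cInf_lower) (use assms in \<open>auto intro!: bdd_belowI[of _ 0]\<close>)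

text \<open>Cross-multiplication with an arbitrary upper fraction leaves an inequality between
  natural numbers, where \<open>\<sqsubseteq>\<close> is the usual order.\<close>

lemma le_cut:
  assumes q: "q > 0" and le: "of_nat p \<sqsubseteq> of_nat q * t"
  shows "real p / real q \<le> cut t"
  unfolding cut_def
proof (rule cInf_greatest)
  obtain n where "t \<sqsubseteq> of_nat n" using le_of_nat by blast
  then have "(1::nat) > 0" "of_nat 1 * t \<sqsubseteq> of_nat n" by simp_all
  then show "{real p / real q |p q. q > 0 \<and> of_nat q * t \<sqsubseteq> of_nat p} \<noteq> {}"
    by blast
next
  fix r assume "r \<in> {real p / real q |p q. q > 0 \<and> of_nat q * t \<sqsubseteq> of_nat p}"
  then obtain p' q' where r: "r = real p' / real q'" and q': "q' > 0" and le': "of_nat q' * t \<sqsubseteq> of_nat p'"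
    by auto
  have "of_nat q' * of_nat p \<sqsubseteq> of_nat q' * (of_nat q * t)"
    using le by (rule le_mult_left)
  also have "of_nat q' * (of_nat q * t) = of_nat q * (of_nat q' * t)"
    by (simp add: algebra_simps)
  also have "of_nat q * (of_nat q' * t) \<sqsubseteq> of_nat q * of_nat p'"
    using le' by (rule le_mult_left)
  finally (le_trans) have "of_nat (q' * p) \<sqsubseteq> of_nat (q * p')" by simp
  then have "q' * p \<le> q * p'" by (simp only: of_nat_preorder_iff)
  then have "real (q' * p) \<le> real (q * p')" by (rule of_nat_mono)
  then have "real q' * real p \<le> real q * real p'" by simp
  then show "real p / real q \<le> r"
    using q q' unfolding r by (simp add: field_simps)
qed

lemma cut_nonneg: "0 \<le> cut t"
  using le_cut[of 1 0 t] zero_le by simp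

text \<open>Totality makes the one-sided infimum a two-sided approximation: if
  \<open>of_nat n * t\<close> is not below \<open>of_nat p\<close>, then it is above, and
  \<open>p / n\<close> is a lower bound of the cut.\<close>

lemma cut_upper:
  assumes "n > 0"
  obtains p where "of_nat n * t \<sqsubseteq> of_nat p" "real p / real n \<le> cut t + 2 / real n"
proof
  \<comment> \<open>The summand 1 makes \<open>p\<close> strictly larger than
    \<open>n * cut t\<close>; with equality, \<open>of_nat p \<sqsubseteq> of_nat n * t\<close>
    would not be contradictory. Rounding and this summand together cost at most 2.\<close>
  define p where "p = nat \<lceil>real n * cut t\<rceil> + 1"
  have p: "real n * cut t < real p" "real p \<le> real n * cut t + 2"
    using mult_nonneg_nonneg[OF _ cut_nonneg, of "real n" t] unfolding p_def by linarith+
  show "of_nat n * t \<sqsubseteq> of_nat p"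
  proof (rule ccontr)
    assume "\<not> ?thesis"
    then have "real p / real n \<le> cut t"
      using le_total le_cut[OF assms] by blast
    then show False using p(1) assms by (simp add: field_simps)
  qed
  have "cut t \<ge> (real p - 2) / real n"
    using p(2) assms by (simp add: field_simps)
  then show "real p / real n \<le> cut t + 2 / real n"
    by (simp add: diff_divide_distrib)
qed

lemma cut_lower:
  assumes "n > 0"
  obtains p where "of_nat p \<sqsubseteq> of_nat n * t" "cut t - 1 / real n \<le> real p / real n"
proof
  \<comment> \<open>A positive \<open>p\<close> is strictly below \<open>n * cut t\<close>.
    Truncation by \<open>nat\<close> gives \<open>p = 0\<close> when the cut vanishes, and
    \<open>p = 0\<close> is covered by \<open>zero_le\<close>.\<close>
  define p where "p = nat (\<lceil>real n * cut t\<rceil> - 1)"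
  have p: "real n * cut t \<le> real p + 1" "p > 0 \<Longrightarrow> real p < real n * cut t"
    using cut_nonneg[of t] unfolding p_def by linarith+
  show "of_nat p \<sqsubseteq> of_nat n * t"
  proof (cases "p = 0")
    case True
    then show ?thesis by (simp add: zero_le)
  next
    case False
    show ?thesis
    proof (rule ccontr)
      assume "\<not> ?thesis"
      then have "cut t \<le> real p / real n"
        using le_total cut_le[OF assms] by blast
      then show False using p(2) False assms by (simp add: field_simps)
    qed
  qed
  have "cut t \<le> (real p + 1) / real n"
    using p(1) assms by (simp add: field_simps)
  then show "cut t - 1 / real n \<le> real p / real n"
    by (simp add: add_divide_distrib)
qed

lemma le_of_le_add_inverse:
  fixes x y c :: real
  assumes "\<And>n. n > 0 \<Longrightarrow> x \<le> y + c / real n"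
  shows "x \<le> y"
proof (rule LIMSEQ_le_const)
  show "(\<lambda>n. y + c / real n) \<longlonglongrightarrow> y"
    using tendsto_add[OF tendsto_const lim_const_over_n] by (metis add.right_neutral)
  show "\<exists>N. \<forall>n\<ge>N. x \<le> y + c / real n"
    using assms by (intro exI[of _ 1]) auto
qed

lemma cut_mono:
  assumes "a \<sqsubseteq> b"
  shows "cut a \<le> cut b"
proof (rule le_of_le_add_inverse[of _ _ 2])
  fix n :: nat assume n: "n > 0"
  obtain p where p: "of_nat n * b \<sqsubseteq> of_nat p" "real p / real n \<le> cut b + 2 / real n"
    using cut_upper[OF n] .
  show "cut a \<le> cut b + 2 / real n"
    using cut_le[OF n le_trans[OF le_mult_left[OF assms] p(1)]] p(2) by simp
qed

lemma cut_add: "cut (a + b) = cut a + cut b"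
proof (rule antisym)
  show "cut (a + b) \<le> cut a + cut b"
  proof (rule le_of_le_add_inverse[of _ _ 4])
    fix n :: nat assume n: "n > 0"
    obtain p where p: "of_nat n * a \<sqsubseteq> of_nat p" "real p / real n \<le> cut a + 2 / real n"
      using cut_upper[OF n] .
    obtain q where q: "of_nat n * b \<sqsubseteq> of_nat q" "real q / real n \<le> cut b + 2 / real n"
      using cut_upper[OF n] .
    have "of_nat n * (a + b) \<sqsubseteq> of_nat (p + q)"
      using le_add_mono[OF p(1) q(1)] by (simp add: algebra_simps)
    then have "cut (a + b) \<le> real p / real n + real q / real n"
      using cut_le[OF n] by (fastforce simp: add_divide_distrib)
    then show "cut (a + b) \<le> cut a + cut b + 4 / real n" using p(2) q(2) by simp
  qed
  show "cut a + cut b \<le> cut (a + b)"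
  proof (rule le_of_le_add_inverse[of _ _ 2])
    fix n :: nat assume n: "n > 0"
    obtain p where p: "of_nat p \<sqsubseteq> of_nat n * a" "cut a - 1 / real n \<le> real p / real n"
      using cut_lower[OF n] .
    obtain q where q: "of_nat q \<sqsubseteq> of_nat n * b" "cut b - 1 / real n \<le> real q / real n"
      using cut_lower[OF n] .
    have "of_nat (p + q) \<sqsubseteq> of_nat n * (a + b)"
      using le_add_mono[OF p(1) q(1)] by (simp add: algebra_simps)
    then have "real p / real n + real q / real n \<le> cut (a + b)"
      using le_cut[OF n] by (fastforce simp: add_divide_distrib)
    then show "cut a + cut b \<le> cut (a + b) + 2 / real n" using p(2) q(2) by simp
  qed
qed

lemma cut_mult: "cut (a * b) = cut a * cut b"
proof (rule antisym)
  show "cut (a * b) \<le> cut a * cut b"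
  proof (rule LIMSEQ_le_const)
    have "(\<lambda>n. (cut a + 2 / real n) * (cut b + 2 / real n)) \<longlonglongrightarrow> (cut a + 0) * (cut b + 0)"
      by (intro tendsto_intros lim_const_over_n)
    then show "(\<lambda>n. (cut a + 2 / real n) * (cut b + 2 / real n)) \<longlonglongrightarrow> cut a * cut b"
      by simp
    show "\<exists>N. \<forall>n\<ge>N. cut (a * b) \<le> (cut a + 2 / real n) * (cut b + 2 / real n)"
    proof (intro exI[of _ 1] allI impI)
      fix n :: nat assume "n \<ge> 1"
      then have n: "n > 0" by simp
      obtain p where p: "of_nat n * a \<sqsubseteq> of_nat p" "real p / real n \<le> cut a + 2 / real n"
        using cut_upper[OF n] .
      obtain q where q: "of_nat n * b \<sqsubseteq> of_nat q" "real q / real n \<le> cut b + 2 / real n"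
        using cut_upper[OF n] .
      have "of_nat (n * n) * (a * b) \<sqsubseteq> of_nat (p * q)"
        using le_mult_mono[OF p(1) q(1)] by (simp add: algebra_simps)
      then have "cut (a * b) \<le> (real p / real n) * (real q / real n)"
        using cut_le[of "n * n" "a * b" "p * q"] n by simp
      also have "\<dots> \<le> (cut a + 2 / real n) * (cut b + 2 / real n)"
        using p(2) q(2) cut_nonneg[of a] by (intro mult_mono) auto
      finally show "cut (a * b) \<le> (cut a + 2 / real n) * (cut b + 2 / real n)" .
    qed
  qed
  show "cut a * cut b \<le> cut (a * b)"
  \<comment> \<open>The lower approximations \<open>cut a - 1 / n\<close> and
    \<open>cut b - 1 / n\<close> can be negative, and then they cannot be multiplied monotonically.
    For positive cuts they are positive from some n on; a vanishing cut makes the claim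
    trivial.\<close>
  proof (cases "cut a = 0 \<or> cut b = 0")
    case True
    then show ?thesis using cut_nonneg by auto
  next
    case False
    then have ab: "cut a > 0" "cut b > 0" using cut_nonneg[of a] cut_nonneg[of b] by linarith+
    show ?thesis
    proof (rule LIMSEQ_le_const2)
      have lim: "(\<lambda>n. cut c - 1 / real n) \<longlonglongrightarrow> cut c" for c
        using tendsto_diff[OF tendsto_const lim_const_over_n] by (metis diff_zero)
      show "(\<lambda>n. (cut a - 1 / real n) * (cut b - 1 / real n)) \<longlonglongrightarrow> cut a * cut b"
        by (intro tendsto_mult lim)
      have "\<forall>\<^sub>F n in sequentially. cut a - 1 / real n > 0 \<and> cut b - 1 / real n > 0"
        using order_tendstoD(1)[OF lim ab(1)] order_tendstoD(1)[OF lim ab(2)]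
        by (rule eventually_conj)
      then obtain N where N: "\<And>n. n \<ge> N \<Longrightarrow> cut a - 1 / real n > 0 \<and> cut b - 1 / real n > 0"
        by (auto simp: eventually_sequentially)
      show "\<exists>N. \<forall>n\<ge>N. (cut a - 1 / real n) * (cut b - 1 / real n) \<le> cut (a * b)"
      proof (intro exI[of _ "max 1 N"] allI impI)
        fix n :: nat assume "n \<ge> max 1 N"
        then have n: "n > 0" and nN: "n \<ge> N" by simp_all
        obtain p where p: "of_nat p \<sqsubseteq> of_nat n * a" "cut a - 1 / real n \<le> real p / real n"
          using cut_lower[OF n] .
        obtain q where q: "of_nat q \<sqsubseteq> of_nat n * b" "cut b - 1 / real n \<le> real q / real n"
          using cut_lower[OF n] .
        have "of_nat (p * q) \<sqsubseteq> of_nat (n * n) * (a * b)"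
          using le_mult_mono[OF p(1) q(1)] by (simp add: algebra_simps)
        then have *: "(real p / real n) * (real q / real n) \<le> cut (a * b)"
          using le_cut[of "n * n" "p * q" "a * b"] n by simp
        have "(cut a - 1 / real n) * (cut b - 1 / real n) \<le> (real p / real n) * (real q / real n)"
          using p(2) q(2) N[OF nN] by (intro mult_mono) auto
        then show "(cut a - 1 / real n) * (cut b - 1 / real n) \<le> cut (a * b)" using * by simp
      qed
    qed
  qed
qed

lemma cut_eq_\<phi>:
  assumes s: "s \<in> S"
  shows "cut s = \<phi> s"
proof (rule antisym)
  show "cut s \<le> \<phi> s"
  proof (rule le_of_le_add_inverse[of _ _ 1])
    fix n :: nat assume n: "n > 0"
    obtain p where p: "of_nat p \<sqsubseteq> of_nat n * s" "cut s - 1 / real n \<le> real p / real n"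
      using cut_lower[OF n] .
    have "real p \<le> real n * \<phi> s"
      using p(1) s by (simp add: le_iff_\<phi>_le mult_S of_nat_S \<phi>_mult \<phi>_of_nat)
    then have "real p / real n \<le> \<phi> s" using n by (simp add: field_simps)
    then show "cut s \<le> \<phi> s + 1 / real n" using p(2) by simp
  qed
  show "\<phi> s \<le> cut s"
  proof (rule le_of_le_add_inverse[of _ _ 2])
    fix n :: nat assume n: "n > 0"
    obtain p where p: "of_nat n * s \<sqsubseteq> of_nat p" "real p / real n \<le> cut s + 2 / real n"
      using cut_upper[OF n] .
    have "real n * \<phi> s \<le> real p"
      using p(1) s by (simp add: le_iff_\<phi>_le mult_S of_nat_S \<phi>_mult \<phi>_of_nat)
    then have "\<phi> s \<le> real p / real n" using n by (simp add: field_simps)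
    then show "\<phi> s \<le> cut s + 2 / real n" using p(2) by simp
  qed
qed

end

section \<open>Existence of a maximal preorder\<close>

context subsemiring_point
begin

lemma subsemiring_point_Union:
  assumes ne: "C \<noteq> {}" and chain: "\<And>R R'. R \<in> C \<Longrightarrow> R' \<in> C \<Longrightarrow> R \<subseteq> R' \<or> R' \<subseteq> R"
    and pt: "\<And>R. R \<in> C \<Longrightarrow> subsemiring_point (\<lambda>x y. (x, y) \<in> R) S \<phi>"
  shows "subsemiring_point (\<lambda>x y. (x, y) \<in> \<Union>C) S \<phi>"
proof -
  obtain R0 where R0: "R0 \<in> C" using ne by blast
  have sp: "semiring_preorder (\<lambda>x y. (x, y) \<in> R)" if "R \<in> C" for R
    using pt[OF that] by (simp add: subsemiring_point_def)
  show ?thesis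
  proof
    show "(x, x) \<in> \<Union>C" for x
      using R0 semiring_preorder.le_refl[OF sp] by blast
    show "(x, z) \<in> \<Union>C" if xy: "(x, y) \<in> \<Union>C" and yz: "(y, z) \<in> \<Union>C" for x y z
    proof -
      \<comment> \<open>Transitivity is where the chain condition enters: both relations must hold
        in a common member.\<close>
      obtain R R' where R: "R \<in> C" "(x, y) \<in> R" "R' \<in> C" "(y, z) \<in> R'" using xy yz by blast
      then obtain R'' where "R'' \<in> C" "(x, y) \<in> R''" "(y, z) \<in> R''" using chain by blast
      then show ?thesis using semiring_preorder.le_trans[OF sp] by blast
    qed
    show "(x + z, y + z) \<in> \<Union>C" if "(x, y) \<in> \<Union>C" for x y z
      using that semiring_preorder.le_add[OF sp] by blast
    show "(x * z, y * z) \<in> \<Union>C" if "(x, y) \<in> \<Union>C" for x y z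
      using that semiring_preorder.le_mult[OF sp] by blast
    show "(0, x) \<in> \<Union>C" for x
      using R0 semiring_preorder.zero_le[OF sp] by blast
    show "\<exists>n. (x, of_nat n) \<in> \<Union>C" for x
      using R0 semiring_preorder.le_of_nat[OF sp] by blast
    show "\<phi> x \<le> \<phi> y" if "x \<in> S" "y \<in> S" "(x, y) \<in> \<Union>C" for x y
      using that subsemiring_point.\<phi>_mono[OF pt] by blast
  qed (auto simp: zero_S one_S add_S mult_S \<phi>_add \<phi>_mult \<phi>_one)
qed

theorem extension:
  obtains \<psi> :: "'b \<Rightarrow> real" where
    "\<And>x y. \<psi> (x + y) = \<psi> x + \<psi> y" "\<And>x y. \<psi> (x * y) = \<psi> x * \<psi> y"
    "\<And>x. 0 \<le> \<psi> x" "\<And>x y. x \<sqsubseteq> y \<Longrightarrow> \<psi> x \<le> \<psi> y" "\<And>s. s \<in> S \<Longrightarrow> \<psi> s = \<phi> s"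
proof -
  \<comment> \<open>Preorders are taken as sets of pairs, so that Zorn's lemma applies to inclusion;
    the second condition keeps the given preorder inside the maximal one.\<close>
  define \<A> where "\<A> = {R. subsemiring_point (\<lambda>x y. (x, y) \<in> R) S \<phi> \<and> {(x, y). x \<sqsubseteq> y} \<subseteq> R}"
  have "{(x, y). x \<sqsubseteq> y} \<in> \<A>"
    by (simp add: \<A>_def subsemiring_point_axioms)
  then have "\<A> \<noteq> {}" by blast
  moreover have "\<Union>C \<in> \<A>" if "C \<noteq> {}" "subset.chain \<A> C" for C
    using that subsemiring_point_Union[of C] unfolding \<A>_def subset_chain_def by blast
  ultimately obtain M where M: "M \<in> \<A>" and max: "\<And>X. X \<in> \<A> \<Longrightarrow> M \<subseteq> X \<Longrightarrow> X = M"
    using subset_Zorn_nonempty[of \<A>] by blast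
  interpret M: subsemiring_point "\<lambda>x y. (x, y) \<in> M" S \<phi>
    using M by (simp add: \<A>_def)
  interpret M: maximal_subsemiring_point "\<lambda>x y. (x, y) \<in> M" S \<phi>
  proof
    fix le' :: "'b \<Rightarrow> 'b \<Rightarrow> bool" and x y
    assume le': "subsemiring_point le' S \<phi>" "\<And>x y. (x, y) \<in> M \<Longrightarrow> le' x y" "le' x y"
    then have "{(x, y). le' x y} \<in> \<A>"
      using M by (auto simp: \<A>_def)
    then have "{(x, y). le' x y} = M"
      using le'(2) by (intro max) auto
    then show "(x, y) \<in> M" using le'(3) by blast
  qed
  show thesis
  proof
    show "M.cut x \<le> M.cut y" if "x \<sqsubseteq> y" for x y
      using that M by (intro M.cut_mono) (auto simp: \<A>_def)
  qed (simp_all add: M.cut_add M.cut_mult M.cut_nonneg M.cut_eq_\<phi>)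
qed

end

section \<open>Restriction of tensors\<close>

lemma indices_iff: "is \<in> indices ds \<longleftrightarrow> length is = length ds \<and> (\<forall>l<length ds. is ! l < ds ! l)"
  by (auto simp: indices_def list_all2_conv_all_nth)

lemma indices_Cons: "indices (d # ds) = (\<lambda>(i, is). i # is) ` ({..<d} \<times> indices ds)"
  by (auto simp: indices_def list_all2_Cons2)

text \<open>Distributivity: choosing one summand in every factor amounts to choosing a multi-index.
  This is what evaluates composed restrictions.\<close>

lemma sum_indices_prod:
  fixes b :: "nat \<Rightarrow> nat \<Rightarrow> 'a::comm_semiring_1"
  shows "(\<Sum>js\<in>indices ds. \<Prod>l<length ds. b l (js ! l)) = (\<Prod>l<length ds. \<Sum>j<ds ! l. b l j)"
proof (induction ds arbitrary: b)
  case Nil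
  have "indices [] = {[]}" by (auto simp: indices_def)
  then show ?case by simp
next
  case (Cons d ds)
  have inj: "inj_on (\<lambda>(i, is). i # is) ({..<d} \<times> indices ds)"
    by (auto simp: inj_on_def)
  have "(\<Sum>js\<in>indices (d # ds). \<Prod>l<length (d # ds). b l (js ! l))
      = (\<Sum>(i, is)\<in>{..<d} \<times> indices ds. b 0 i * (\<Prod>l<length ds. b (Suc l) (is ! l)))"
    unfolding indices_Cons sum.reindex[OF inj]
    by (intro sum.cong refl) (auto simp: prod.lessThan_Suc_shift simp del: prod.lessThan_Suc)
  also have "\<dots> = (\<Sum>i<d. b 0 i) * (\<Sum>is\<in>indices ds. \<Prod>l<length ds. b (Suc l) (is ! l))"
    unfolding sum_product sum.cartesian_product ..
  also have "\<dots> = (\<Prod>l<length (d # ds). \<Sum>j<(d # ds) ! l. b l j)"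
    using Cons[of "\<lambda>l. b (Suc l)"] by (simp add: prod.lessThan_Suc_shift del: prod.lessThan_Suc)
  finally show ?case .
qed

lemma prod_if_one_zero:
  "(\<Prod>l<(k::nat). if P l then 1 else 0) = (if \<forall>l<k. P l then 1 else (0::'a::comm_semiring_1))"
  by (induction k) (auto simp: less_Suc_eq)

text \<open>Matrices are traded for bare coefficient functions, whose values outside the index
  ranges do not matter, so that restrictions can be given by formulas.\<close>

lemma restricts_iff:
  fixes f g :: "'a::comm_semiring_1 tensor"
  shows "restricts g f \<longleftrightarrow> length (dims g) = length (dims f) \<and>
    (\<exists>a. \<forall>is\<in>indices (dims g). entry g is =
      (\<Sum>js\<in>indices (dims f). (\<Prod>l<length (dims f). a l (is ! l) (js ! l)) * entry f js))"
    (is "_ \<longleftrightarrow> ?len \<and> (\<exists>a. ?R a)")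
proof
  assume "restricts g f"
  then obtain As where As: "map dim_col As = dims f" "g = tensor_apply As f"
    by (auto simp: restricts_def)
  have len: "length (dims f) = length As" by (simp flip: As(1))
  have "?R (\<lambda>l i j. (As ! l) $$ (i, j))"
    unfolding len using As(2) by (simp add: tensor_apply_def)
  moreover have ?len
    using As(2) len by (simp add: tensor_apply_def)
  ultimately show "?len \<and> (\<exists>a. ?R a)"
    by (intro conjI exI[of _ "\<lambda>l i j. (As ! l) $$ (i, j)"])
next
  assume "?len \<and> (\<exists>a. ?R a)"
  then obtain a where len: ?len and a: "?R a" by blast
  define As where "As = map (\<lambda>l. mat (dims g ! l) (dims f ! l) (\<lambda>(i, j). a l i j)) [0..<length (dims f)]"
  have "map dim_row As = dims g"
    by (rule nth_equalityI) (simp_all add: As_def len)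
  moreover have "(As ! l) $$ (is ! l, js ! l) = a l (is ! l) (js ! l)"
    if "is \<in> indices (dims g)" "js \<in> indices (dims f)" "l < length (dims f)" for "is" js l
    using that len by (simp add: As_def indices_iff)
  moreover have "length As = length (dims f)" by (simp add: As_def)
  ultimately have "g = tensor_apply As f"
    using a by (intro tensor_eqI) (simp_all add: tensor_apply_def)
  moreover have "map dim_col As = dims f"
    by (rule nth_equalityI) (simp_all add: As_def)
  ultimately show "restricts g f" unfolding restricts_def by blast
qed

lemma restricts_length: "restricts g f \<Longrightarrow> length (dims g) = length (dims f)"
  by (simp add: restricts_iff)

text \<open>The l-th map is the 0/1 matrix that reads off coordinate \<open>\<sigma> l i\<close>,
  and the sum over multi-indices collapses to one term. Renumberings of bases become restrictions in
  this way.\<close>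

lemma restricts_reindex:
  fixes f g :: "'a::comm_semiring_1 tensor"
  assumes len: "length (dims g) = k" "length (dims f) = k"
    and in_range: "\<And>is. is \<in> indices (dims g) \<Longrightarrow> map (\<lambda>l. \<sigma> l (is ! l)) [0..<k] \<in> indices (dims f)"
    and entries: "\<And>is. is \<in> indices (dims g) \<Longrightarrow>
      entry g is = entry f (map (\<lambda>l. \<sigma> l (is ! l)) [0..<k])"
  shows "restricts g f"
proof -
  have "entry g is = (\<Sum>js\<in>indices (dims f).
      (\<Prod>l<length (dims f). if js ! l = \<sigma> l (is ! l) then 1 else 0) * entry f js)"
    if "is \<in> indices (dims g)" for "is"
  proof -
    let ?s = "map (\<lambda>l. \<sigma> l (is ! l)) [0..<k]"
    have *: "(\<forall>l<length (dims f). js ! l = \<sigma> l (is ! l)) \<longleftrightarrow> js = ?s" if "js \<in> indices (dims f)" for js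
      using that len by (auto simp: indices_iff list_eq_iff_nth_eq)
    have "(\<Sum>js\<in>indices (dims f).
        (\<Prod>l<length (dims f). if js ! l = \<sigma> l (is ! l) then 1 else 0) * entry f js)
      = (\<Sum>js\<in>indices (dims f). if js = ?s then entry f js else 0)"
      by (intro sum.cong refl) (auto simp: prod_if_one_zero *)
    also have "\<dots> = entry g is"
      using in_range[OF that] entries[OF that] by (simp add: finite_indices)
    finally show ?thesis by simp
  qed
  then show ?thesis
    unfolding restricts_iff using len
    by (intro conjI exI[of _ "\<lambda>l i j. if j = \<sigma> l i then 1 else 0"]) auto
qed

lemma restricts_refl: "restricts f f"
proof (rule restricts_reindex[where \<sigma> = "\<lambda>l i. i"])
  fix "is" assume "is \<in> indices (dims f)"
  then have "map (\<lambda>l. is ! l) [0..<length (dims f)] = is"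
    using map_nth[of "is"] by (simp add: indices_iff)
  with \<open>is \<in> indices (dims f)\<close>
  show "map (\<lambda>l. is ! l) [0..<length (dims f)] \<in> indices (dims f)"
    "entry f is = entry f (map (\<lambda>l. is ! l) [0..<length (dims f)])" by simp_all
qed simp_all

text \<open>The matrices are multiplied factor by factor; \<open>sum_indices_prod\<close> splits the
  sum over the intermediate multi-indices accordingly.\<close>

lemma restricts_trans:
  fixes f g h :: "'a::comm_semiring_1 tensor"
  assumes "restricts h g" "restricts g f"
  shows "restricts h f"
proof -
  define k where "k = length (dims f)"
  have k: "length (dims f) = k" "length (dims g) = k" "length (dims h) = k"
    using assms[THEN restricts_length] by (simp_all add: k_def)
  obtain a where a: "\<And>is. is \<in> indices (dims h) \<Longrightarrow>
      entry h is = (\<Sum>js\<in>indices (dims g). (\<Prod>l<k. a l (is ! l) (js ! l)) * entry g js)"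
    using assms(1) by (auto simp: restricts_iff k)
  obtain b where b: "\<And>is. is \<in> indices (dims g) \<Longrightarrow>
      entry g is = (\<Sum>js\<in>indices (dims f). (\<Prod>l<k. b l (is ! l) (js ! l)) * entry f js)"
    using assms(2) by (auto simp: restricts_iff k)
  have "entry h is = (\<Sum>ms\<in>indices (dims f).
      (\<Prod>l<k. \<Sum>j<dims g ! l. a l (is ! l) j * b l j (ms ! l)) * entry f ms)"
    if "is \<in> indices (dims h)" for "is"
  proof -
    have "entry h is = (\<Sum>js\<in>indices (dims g). (\<Prod>l<k. a l (is ! l) (js ! l)) *
        (\<Sum>ms\<in>indices (dims f). (\<Prod>l<k. b l (js ! l) (ms ! l)) * entry f ms))"
      using a[OF that] b by simp
    also have "\<dots> = (\<Sum>js\<in>indices (dims g). \<Sum>ms\<in>indices (dims f).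
        (\<Prod>l<k. a l (is ! l) (js ! l) * b l (js ! l) (ms ! l)) * entry f ms)"
      by (simp add: sum_distrib_left prod.distrib mult.assoc)
    also have "\<dots> = (\<Sum>ms\<in>indices (dims f).
        (\<Sum>js\<in>indices (dims g). \<Prod>l<k. a l (is ! l) (js ! l) * b l (js ! l) (ms ! l)) * entry f ms)"
      by (subst sum.swap) (simp add: sum_distrib_right)
    also have "\<dots> = (\<Sum>ms\<in>indices (dims f).
        (\<Prod>l<k. \<Sum>j<dims g ! l. a l (is ! l) j * b l j (ms ! l)) * entry f ms)"
    proof (intro sum.cong refl arg_cong2[where f = "(*)"])
      fix ms
      show "(\<Sum>js\<in>indices (dims g). \<Prod>l<k. a l (is ! l) (js ! l) * b l (js ! l) (ms ! l))
        = (\<Prod>l<k. \<Sum>j<dims g ! l. a l (is ! l) j * b l j (ms ! l))"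
        using sum_indices_prod[of "\<lambda>l j. a l (is ! l) j * b l j (ms ! l)" "dims g"] unfolding k .
    qed
    finally show ?thesis .
  qed
  then show ?thesis
    unfolding restricts_iff using k
    by (intro conjI exI[of _ "\<lambda>l i m. \<Sum>j<dims g ! l. a l i j * b l j m"]) auto
qed

section \<open>Compatibility of restriction with direct sums and tensor products\<close>

lemma dims_tensor_sum: "dims (tensor_sum f g) = map2 (+) (dims f) (dims g)"
  by (simp add: tensor_sum_def)

lemma dims_tensor_prod: "dims (tensor_prod f g) = map2 (*) (dims f) (dims g)"
  by (simp add: tensor_prod_def)

lemma entry_tensor_sum:
  assumes len: "length (dims f) = k" "length (dims g) = k"
    and "is": "is \<in> indices (dims (tensor_sum f g))"
  shows "entry (tensor_sum f g) is =
    (if \<forall>l<k. is ! l < dims f ! l then entry f is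
     else if \<forall>l<k. dims f ! l \<le> is ! l
       then entry g (map (\<lambda>l. is ! l - dims f ! l) [0..<k]) else 0)"
proof -
  have l: "length is = k" using "is" len by (simp add: indices_iff dims_tensor_sum)
  then have m: "map2 (-) is (dims f) = map (\<lambda>l. is ! l - dims f ! l) [0..<k]"
    using len by (simp add: list_eq_iff_nth_eq)
  have ll: "list_all2 (<) is (dims f) \<longleftrightarrow> (\<forall>l<k. is ! l < dims f ! l)"
    "list_all2 (\<lambda>x y. y \<le> x) is (dims f) \<longleftrightarrow> (\<forall>l<k. dims f ! l \<le> is ! l)"
    using l len by (auto simp: list_all2_conv_all_nth)
  have "entry (tensor_sum f g) is = (if list_all2 (<) is (dims f) then entry f is
      else if list_all2 (\<lambda>x y. y \<le> x) is (dims f) then entry g (map2 (-) is (dims f)) else 0)"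
    unfolding tensor_sum_def using "is" by (subst entry_tensor) (simp_all add: dims_tensor_sum)
  then show ?thesis unfolding ll m .
qed

lemma entry_tensor_prod:
  assumes len: "length (dims f) = k" "length (dims g) = k"
    and "is": "is \<in> indices (dims (tensor_prod f g))"
  shows "entry (tensor_prod f g) is =
    entry f (map (\<lambda>l. is ! l div dims g ! l) [0..<k]) * entry g (map (\<lambda>l. is ! l mod dims g ! l) [0..<k])"
proof -
  have l: "length is = k" using "is" len by (simp add: indices_iff dims_tensor_prod)
  then have "map2 (div) is (dims g) = map (\<lambda>l. is ! l div dims g ! l) [0..<k]"
    "map2 (mod) is (dims g) = map (\<lambda>l. is ! l mod dims g ! l) [0..<k]"
    using len by (simp_all add: list_eq_iff_nth_eq)
  then show ?thesis
    using "is" l len by (simp add: tensor_prod_def)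
qed

lemma sum_indices_add:
  fixes F :: "nat list \<Rightarrow> 'a::comm_monoid_add"
  assumes k: "k > 0" and len: "length ds = k" "length es = k"
    and zero: "\<And>js. js \<in> indices (map2 (+) ds es) \<Longrightarrow> \<not> (\<forall>l<k. js ! l < ds ! l) \<Longrightarrow>
      \<not> (\<forall>l<k. ds ! l \<le> js ! l) \<Longrightarrow> F js = 0"
  shows "(\<Sum>js\<in>indices (map2 (+) ds es). F js) =
    (\<Sum>js\<in>indices ds. F js) + (\<Sum>js\<in>indices es. F (map (\<lambda>l. ds ! l + js ! l) [0..<k]))"
proof -
  let ?sh = "\<lambda>js. map (\<lambda>l. ds ! l + js ! l) [0..<k]"
  have inj: "inj_on ?sh (indices es)"
    using len by (auto simp: inj_on_def indices_iff list_eq_iff_nth_eq)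
  have "(\<Sum>js\<in>indices (map2 (+) ds es). F js) = (\<Sum>js\<in>indices ds \<union> ?sh ` indices es. F js)"
  proof (rule sum.mono_neutral_right)
    show "indices ds \<union> ?sh ` indices es \<subseteq> indices (map2 (+) ds es)"
      using len by (auto simp: indices_iff trans_less_add1)
    show "\<forall>js\<in>indices (map2 (+) ds es) - (indices ds \<union> ?sh ` indices es). F js = 0"
    proof
      fix js assume js: "js \<in> indices (map2 (+) ds es) - (indices ds \<union> ?sh ` indices es)"
      show "F js = 0"
      proof (rule zero)
        show "js \<in> indices (map2 (+) ds es)" using js by blast
        show "\<not> (\<forall>l<k. js ! l < ds ! l)"
          using js len by (auto simp: indices_iff)
        show "\<not> (\<forall>l<k. ds ! l \<le> js ! l)"
        proof
          assume ge: "\<forall>l<k. ds ! l \<le> js ! l"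
          let ?ms = "map (\<lambda>l. js ! l - ds ! l) [0..<k]"
          have "?ms \<in> indices es" "js = ?sh ?ms"
            using js len ge by (auto simp: indices_iff list_eq_iff_nth_eq less_diff_conv2 add.commute)
          then show False using js by blast
        qed
      qed
    qed
  qed (rule finite_indices)
  also have "\<dots> = (\<Sum>js\<in>indices ds. F js) + (\<Sum>js\<in>?sh ` indices es. F js)"
  proof (rule sum.union_disjoint)
    \<comment> \<open>For \<open>k = 0\<close> the empty index would lie in both blocks; position 0
      separates them.\<close>
    show "indices ds \<inter> ?sh ` indices es = {}"
    proof -
      have "\<not> ?sh js \<in> indices ds" for js
        using k len by (auto simp: indices_iff intro!: exI[of _ 0])
      then show ?thesis by blast
    qed
  qed (simp_all add: finite_indices)
  also have "(\<Sum>js\<in>?sh ` indices es. F js) = (\<Sum>js\<in>indices es. F (?sh js))"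
    using sum.reindex[OF inj, of F] by simp
  finally show ?thesis .
qed

lemma mult_add_less:
  fixes i j d e :: nat
  assumes "i < d" "j < e"
  shows "i * e + j < d * e"
proof -
  have "i * e + j < Suc i * e" using assms by simp
  also have "\<dots> \<le> d * e" using assms by (intro mult_le_mono1) simp
  finally show ?thesis .
qed

lemma mult_add_div_mod:
  fixes m e j :: nat
  assumes "m < e"
  shows "(j * e + m) div e = j" "(j * e + m) mod e = m"
proof -
  have "e \<noteq> 0" using assms by simp
  then show "(j * e + m) div e = j" "(j * e + m) mod e = m" using assms by simp_all
qed

lemma sum_indices_mult:
  fixes F :: "nat list \<Rightarrow> 'a::comm_monoid_add"
  assumes len: "length ds = k" "length es = k"
  shows "(\<Sum>js\<in>indices (map2 (*) ds es). F js) =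
    (\<Sum>js\<in>indices ds. \<Sum>ms\<in>indices es. F (map (\<lambda>l. js ! l * es ! l + ms ! l) [0..<k]))"
  unfolding sum.cartesian_product
proof (rule sum.reindex_bij_witness[where
      i = "\<lambda>(js, ms). map (\<lambda>l. js ! l * es ! l + ms ! l) [0..<k]" and
      j = "\<lambda>is. (map (\<lambda>l. is ! l div es ! l) [0..<k], map (\<lambda>l. is ! l mod es ! l) [0..<k])"])
  fix "is" assume "is": "is \<in> indices (map2 (*) ds es)"
  then have lt: "is ! l < ds ! l * es ! l" if "l < k" for l
    using that len by (simp add: indices_iff)
  have pos: "es ! l > 0" if "l < k" for l
    using lt[OF that] by (cases "es ! l") auto
  show "(map (\<lambda>l. is ! l div es ! l) [0..<k], map (\<lambda>l. is ! l mod es ! l) [0..<k]) \<in> indices ds \<times> indices es"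
    using len lt pos by (auto simp: indices_iff less_mult_imp_div_less)
  have "map (\<lambda>l. map (\<lambda>l. is ! l div es ! l) [0..<k] ! l * es ! l
      + map (\<lambda>l. is ! l mod es ! l) [0..<k] ! l) [0..<k] = is"
    by (rule nth_equalityI) (use "is" len in \<open>simp_all add: indices_iff div_mult_mod_eq\<close>)
  then show *: "(case (map (\<lambda>l. is ! l div es ! l) [0..<k], map (\<lambda>l. is ! l mod es ! l) [0..<k]) of
      (js, ms) \<Rightarrow> map (\<lambda>l. js ! l * es ! l + ms ! l) [0..<k]) = is" by simp
  then show "(case (map (\<lambda>l. is ! l div es ! l) [0..<k], map (\<lambda>l. is ! l mod es ! l) [0..<k]) of
      (js, ms) \<Rightarrow> F (map (\<lambda>l. js ! l * es ! l + ms ! l) [0..<k])) = F is" by simp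
next
  fix p assume p: "p \<in> indices ds \<times> indices es"
  then obtain js ms where p_eq: "p = (js, ms)" and js: "js \<in> indices ds" and ms: "ms \<in> indices es"
    by auto
  have "js ! l * es ! l + ms ! l < ds ! l * es ! l" if "l < k" for l
    using js ms that len by (intro mult_add_less) (simp_all add: indices_iff)
  then show "(case p of (js, ms) \<Rightarrow> map (\<lambda>l. js ! l * es ! l + ms ! l) [0..<k]) \<in> indices (map2 (*) ds es)"
    using len by (simp add: p_eq indices_iff)
  let ?is = "map (\<lambda>l. js ! l * es ! l + ms ! l) [0..<k]"
  have "map (\<lambda>l. ?is ! l div es ! l) [0..<k] = js" "map (\<lambda>l. ?is ! l mod es ! l) [0..<k] = ms"
    by (rule nth_equalityI; use js ms len in \<open>simp add: indices_iff mult_add_div_mod\<close>)+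
  then show "(map (\<lambda>l. (case p of (js, ms) \<Rightarrow> map (\<lambda>l. js ! l * es ! l + ms ! l) [0..<k]) ! l div es ! l) [0..<k],
      map (\<lambda>l. (case p of (js, ms) \<Rightarrow> map (\<lambda>l. js ! l * es ! l + ms ! l) [0..<k]) ! l mod es ! l) [0..<k]) = p"
    by (simp add: p_eq)
qed

lemma restricts_tensor_sum:
  fixes f f' g g' :: "'a::comm_semiring_1 tensor"
  assumes k: "k > 0"
    and "f \<in> tensors k" "f' \<in> tensors k" "g \<in> tensors k" "g' \<in> tensors k"
    and f: "restricts f' f" and g: "restricts g' g"
  shows "restricts (tensor_sum f' g') (tensor_sum f g)"
proof -
  have len: "length (dims f) = k" "length (dims f') = k"
    and len': "length (dims g) = k" "length (dims g') = k"
    using assms by (simp_all add: tensors_def)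
  obtain a where a: "\<And>is. is \<in> indices (dims f') \<Longrightarrow>
      entry f' is = (\<Sum>js\<in>indices (dims f). (\<Prod>l<k. a l (is ! l) (js ! l)) * entry f js)"
    using f by (auto simp: restricts_iff len)
  obtain b where b: "\<And>is. is \<in> indices (dims g') \<Longrightarrow>
      entry g' is = (\<Sum>js\<in>indices (dims g). (\<Prod>l<k. b l (is ! l) (js ! l)) * entry g js)"
    using g by (auto simp: restricts_iff len')
  define d d' where "d = dims f" and "d' = dims f'"
  \<comment> \<open>The block-diagonal matrix with blocks \<open>a l\<close> and
    \<open>b l\<close>.\<close>
  define c where "c l i j = (if i < d' ! l \<and> j < d ! l then a l i j
      else if \<not> i < d' ! l \<and> \<not> j < d ! l then b l (i - d' ! l) (j - d ! l) else 0)" for l i j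
  have c0: "(\<Prod>l<k. c l (is ! l) (js ! l)) = 0" if "l < k" "(is ! l < d' ! l) \<noteq> (js ! l < d ! l)" for l "is" js
    using that by (intro prod_zero) (auto simp: c_def)
  have "entry (tensor_sum f' g') is = (\<Sum>js\<in>indices (dims (tensor_sum f g)).
      (\<Prod>l<k. c l (is ! l) (js ! l)) * entry (tensor_sum f g) js)"
    if "is": "is \<in> indices (dims (tensor_sum f' g'))" for "is"
  proof -
    have lis: "length is = k" and lt: "\<And>l. l < k \<Longrightarrow> is ! l < d' ! l + dims g' ! l"
      using "is" len len' by (auto simp: indices_iff dims_tensor_sum d'_def)
    let ?sh = "\<lambda>js. map (\<lambda>l. d ! l + js ! l) [0..<k]"
    have low: "js \<in> indices (dims (tensor_sum f g))" "entry (tensor_sum f g) js = entry f js"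
      if "js \<in> indices d" for js
    proof -
      show "js \<in> indices (dims (tensor_sum f g))"
        using that len len' by (auto simp: d_def indices_iff dims_tensor_sum trans_less_add1)
      from entry_tensor_sum[OF len(1) len'(1) this] that len
      show "entry (tensor_sum f g) js = entry f js" by (simp add: d_def indices_iff)
    qed
    have high: "?sh js \<in> indices (dims (tensor_sum f g))" "entry (tensor_sum f g) (?sh js) = entry g js"
      if "js \<in> indices (dims g)" for js
    proof -
      show *: "?sh js \<in> indices (dims (tensor_sum f g))"
        using that len len' by (auto simp: d_def indices_iff dims_tensor_sum)
      have "map (\<lambda>l. ?sh js ! l - dims f ! l) [0..<k] = js"
        using that len' by (simp add: list_eq_iff_nth_eq indices_iff d_def)
      moreover have "\<exists>l. l < k" using k by blast
      ultimately show "entry (tensor_sum f g) (?sh js) = entry g js"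
        using entry_tensor_sum[OF len(1) len'(1) *] by (auto simp: d_def)
    qed
    let ?F = "\<lambda>js. (\<Prod>l<k. c l (is ! l) (js ! l)) * entry (tensor_sum f g) js"
    have "(\<Sum>js\<in>indices (map2 (+) d (dims g)). ?F js)
      = (\<Sum>js\<in>indices d. ?F js) + (\<Sum>js\<in>indices (dims g). ?F (?sh js))"
    proof (rule sum_indices_add[OF k])
      fix js
      assume js: "js \<in> indices (map2 (+) d (dims g))" "\<not> (\<forall>l<k. js ! l < d ! l)" "\<not> (\<forall>l<k. d ! l \<le> js ! l)"
      then have "entry (tensor_sum f g) js = 0"
        using entry_tensor_sum[OF len(1) len'(1), of js] unfolding dims_tensor_sum d_def by argo
      then show "?F js = 0" by simp
    qed (use len len' in \<open>simp_all add: d_def\<close>)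
    also have "(\<Sum>js\<in>indices d. ?F js) = (\<Sum>js\<in>indices d. (\<Prod>l<k. c l (is ! l) (js ! l)) * entry f js)"
      by (intro sum.cong refl) (simp add: low)
    also have "(\<Sum>js\<in>indices (dims g). ?F (?sh js))
        = (\<Sum>js\<in>indices (dims g). (\<Prod>l<k. c l (is ! l) (d ! l + js ! l)) * entry g js)"
      by (intro sum.cong refl arg_cong2[where f = "(*)"] prod.cong) (simp_all add: high)
    also have "(\<Sum>js\<in>indices d. (\<Prod>l<k. c l (is ! l) (js ! l)) * entry f js)
        + (\<Sum>js\<in>indices (dims g). (\<Prod>l<k. c l (is ! l) (d ! l + js ! l)) * entry g js)
        = entry (tensor_sum f' g') is"
    proof -
      consider (low) "\<forall>l<k. is ! l < d' ! l" | (high) "\<forall>l<k. d' ! l \<le> is ! l"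
        | (mixed) "\<not> (\<forall>l<k. is ! l < d' ! l)" "\<not> (\<forall>l<k. d' ! l \<le> is ! l)" by blast
      then show ?thesis
      proof cases
        case low
        then have "is \<in> indices d'" using lis len by (simp add: indices_iff d'_def)
        moreover have "(\<Prod>l<k. c l (is ! l) (d ! l + js ! l)) = 0" for js
          using c0[OF k, of "is" "?sh js"] low k by simp
        moreover have "(\<Prod>l<k. c l (is ! l) (js ! l)) = (\<Prod>l<k. a l (is ! l) (js ! l))" if "js \<in> indices d" for js
          using that low len by (intro prod.cong) (auto simp: c_def d_def indices_iff)
        ultimately show ?thesis
          using a[of "is"] entry_tensor_sum[OF len(2) len'(2) "is"] low by (simp add: d_def d'_def)
      next
        case high
        let ?is' = "map (\<lambda>l. is ! l - d' ! l) [0..<k]"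
        have "?is' \<in> indices (dims g')"
          using lt high len' by (auto simp: indices_iff less_diff_conv2 add.commute)
        moreover have "(\<Prod>l<k. c l (is ! l) (js ! l)) = 0" if "js \<in> indices d" for js
          using c0[OF k, of "is" js] high k that len by (simp add: d_def indices_iff leD)
        moreover have "(\<Prod>l<k. c l (is ! l) (d ! l + js ! l)) = (\<Prod>l<k. b l (?is' ! l) (js ! l))" for js
          using high by (intro prod.cong) (auto simp: c_def)
        moreover have "\<not> (\<forall>l<k. is ! l < d' ! l)" using high k by (auto simp: not_less)
        ultimately show ?thesis
          using b[of ?is'] entry_tensor_sum[OF len(2) len'(2) "is"] high by (auto simp: d'_def)
      next
        \<comment> \<open>Position \<open>l\<close> annihilates every term from the first block of
          \<open>tensor_sum f g\<close>, position \<open>m\<close> every term from the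
          second.\<close>
        case mixed
        then obtain l m where lm: "l < k" "\<not> is ! l < d' ! l" "m < k" "is ! m < d' ! m"
          by (auto simp: not_le)
        have "(\<Prod>l<k. c l (is ! l) (js ! l)) = 0" if "js \<in> indices d" for js
          using c0[OF lm(1), of "is" js] lm that len by (simp add: d_def indices_iff)
        moreover have "(\<Prod>l<k. c l (is ! l) (d ! l + js ! l)) = 0" for js
          using c0[OF lm(3), of "is" "?sh js"] lm by simp
        ultimately show ?thesis
          using entry_tensor_sum[OF len(2) len'(2) "is"] mixed by (auto simp: d'_def)
      qed
    qed
    finally show ?thesis by (simp add: dims_tensor_sum d_def)
  qed
  moreover have "length (dims (tensor_sum f g)) = k" "length (dims (tensor_sum f' g')) = k"
    using len len' by (simp_all add: dims_tensor_sum)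
  ultimately show ?thesis
    unfolding restricts_iff by (intro conjI exI[of _ c] ballI) simp_all
qed

lemma entry_tensor_prod_index:
  fixes f g :: "'a::comm_semiring_1 tensor"
  assumes len: "length (dims f) = k" "length (dims g) = k"
    and js: "js \<in> indices (dims f)" and ms: "ms \<in> indices (dims g)"
  shows "entry (tensor_prod f g) (map (\<lambda>l. js ! l * dims g ! l + ms ! l) [0..<k]) = entry f js * entry g ms"
proof -
  let ?is = "map (\<lambda>l. js ! l * dims g ! l + ms ! l) [0..<k]"
  have "js ! l * dims g ! l + ms ! l < dims f ! l * dims g ! l" if "l < k" for l
    using js ms that len by (intro mult_add_less) (simp_all add: indices_iff)
  then have "?is \<in> indices (dims (tensor_prod f g))"
    using len by (simp add: indices_iff dims_tensor_prod)
  moreover have "map (\<lambda>l. ?is ! l div dims g ! l) [0..<k] = js" "map (\<lambda>l. ?is ! l mod dims g ! l) [0..<k] = ms"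
    by (rule nth_equalityI; use js ms len in \<open>simp add: indices_iff mult_add_div_mod\<close>)+
  ultimately show ?thesis
    using entry_tensor_prod[OF len] by simp
qed

lemma restricts_tensor_prod:
  fixes f f' g g' :: "'a::comm_semiring_1 tensor"
  assumes "f \<in> tensors k" "f' \<in> tensors k" "g \<in> tensors k" "g' \<in> tensors k"
    and f: "restricts f' f" and g: "restricts g' g"
  shows "restricts (tensor_prod f' g') (tensor_prod f g)"
proof -
  have len: "length (dims f) = k" "length (dims f') = k"
    and len': "length (dims g) = k" "length (dims g') = k"
    using assms by (simp_all add: tensors_def)
  obtain a where a: "\<And>is. is \<in> indices (dims f') \<Longrightarrow>
      entry f' is = (\<Sum>js\<in>indices (dims f). (\<Prod>l<k. a l (is ! l) (js ! l)) * entry f js)"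
    using f by (auto simp: restricts_iff len)
  obtain b where b: "\<And>is. is \<in> indices (dims g') \<Longrightarrow>
      entry g' is = (\<Sum>js\<in>indices (dims g). (\<Prod>l<k. b l (is ! l) (js ! l)) * entry g js)"
    using g by (auto simp: restricts_iff len')
  define e e' where "e = dims g" and "e' = dims g'"
  \<comment> \<open>The Kronecker product of \<open>a l\<close> and \<open>b l\<close>, in the
    numbering used by \<open>tensor_prod\<close>.\<close>
  define c where "c l i j = a l (i div e' ! l) (j div e ! l) * b l (i mod e' ! l) (j mod e ! l)" for l i j
  have "entry (tensor_prod f' g') is = (\<Sum>js\<in>indices (dims (tensor_prod f g)).
      (\<Prod>l<k. c l (is ! l) (js ! l)) * entry (tensor_prod f g) js)"
    if "is": "is \<in> indices (dims (tensor_prod f' g'))" for "is"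
  proof -
    let ?i = "map (\<lambda>l. is ! l div e' ! l) [0..<k]" and ?i' = "map (\<lambda>l. is ! l mod e' ! l) [0..<k]"
    have lt: "is ! l < dims f' ! l * e' ! l" if "l < k" for l
      using that len len' "is" by (simp add: indices_iff dims_tensor_prod e'_def)
    have pos: "e' ! l > 0" if "l < k" for l
      using lt[OF that] by (cases "e' ! l") auto
    have i: "?i \<in> indices (dims f')" "?i' \<in> indices (dims g')"
      using len len' lt pos by (auto simp: indices_iff less_mult_imp_div_less e'_def)
    have "(\<Sum>js\<in>indices (dims (tensor_prod f g)). (\<Prod>l<k. c l (is ! l) (js ! l)) * entry (tensor_prod f g) js)
      = (\<Sum>js\<in>indices (dims f). \<Sum>ms\<in>indices (dims g). (\<Prod>l<k. c l (is ! l) (js ! l * e ! l + ms ! l))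
          * (entry f js * entry g ms))"
      unfolding dims_tensor_prod sum_indices_mult[OF len(1) len'(1)]
      by (intro sum.cong refl) (simp add: entry_tensor_prod_index[OF len(1) len'(1)] e_def)
    also have "\<dots> = (\<Sum>js\<in>indices (dims f). \<Sum>ms\<in>indices (dims g).
        ((\<Prod>l<k. a l (?i ! l) (js ! l)) * entry f js) * ((\<Prod>l<k. b l (?i' ! l) (ms ! l)) * entry g ms))"
    proof (intro sum.cong refl)
      fix js ms assume "js \<in> indices (dims f)" "ms \<in> indices (dims g)"
      then have "(\<Prod>l<k. c l (is ! l) (js ! l * e ! l + ms ! l))
          = (\<Prod>l<k. a l (?i ! l) (js ! l) * b l (?i' ! l) (ms ! l))"
        using len' by (intro prod.cong) (auto simp: c_def indices_iff e_def)
      then show "(\<Prod>l<k. c l (is ! l) (js ! l * e ! l + ms ! l)) * (entry f js * entry g ms)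
        = ((\<Prod>l<k. a l (?i ! l) (js ! l)) * entry f js) * ((\<Prod>l<k. b l (?i' ! l) (ms ! l)) * entry g ms)"
        by (simp add: prod.distrib mult_ac)
    qed
    also have "\<dots> = entry f' ?i * entry g' ?i'"
      unfolding a[OF i(1)] b[OF i(2)] by (simp add: sum_product)
    also have "\<dots> = entry (tensor_prod f' g') is"
      using entry_tensor_prod[OF len(2) len'(2) "is"] by (simp add: e'_def)
    finally show ?thesis by simp
  qed
  moreover have "length (dims (tensor_prod f g)) = k" "length (dims (tensor_prod f' g')) = k"
    using len len' by (simp_all add: dims_tensor_prod)
  ultimately show ?thesis
    unfolding restricts_iff by (intro conjI exI[of _ c] ballI) simp_all
qed

section \<open>Semiring laws for tensors\<close>

lemma map_nth_id: "length xs = k \<Longrightarrow> map (\<lambda>l. xs ! l) [0..<k] = xs"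
  using map_nth by blast

lemma tensor_sum_in_tensors: "f \<in> tensors k \<Longrightarrow> g \<in> tensors k \<Longrightarrow> tensor_sum f g \<in> tensors k"
  by (simp add: tensors_def dims_tensor_sum)

lemma tensor_prod_in_tensors: "f \<in> tensors k \<Longrightarrow> g \<in> tensors k \<Longrightarrow> tensor_prod f g \<in> tensors k"
  by (simp add: tensors_def dims_tensor_prod)

lemma unit_tensor_in_tensors: "unit_tensor k \<in> tensors k"
  by (simp add: tensors_def unit_tensor_def)

definition zero_tensor :: "nat \<Rightarrow> 'a::zero tensor" where
  "zero_tensor k = tensor (replicate k 0) (\<lambda>_. 0)"

lemma zero_tensor_in_tensors: "zero_tensor k \<in> tensors k"
  by (simp add: tensors_def zero_tensor_def)

lemma indices_zero_tensor: "k > 0 \<Longrightarrow> indices (dims (zero_tensor k)) = {}"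
  by (auto simp: zero_tensor_def indices_iff)

text \<open>As arrays the two sums differ in the order of the blocks, which \<open>\<sigma>\<close>
  exchanges. Commutativity of sum and product is what forces the passage to classes under mutual
  restriction.\<close>

lemma tensor_sum_commute:
  fixes f g :: "'a::comm_semiring_1 tensor"
  assumes k: "k > 0" and fg: "f \<in> tensors k" "g \<in> tensors k"
  shows "restricts (tensor_sum f g) (tensor_sum g f)"
proof (rule restricts_reindex[where k = k and
      \<sigma> = "\<lambda>l i. if i < dims f ! l then dims g ! l + i else i - dims f ! l"])
  have len: "length (dims f) = k" "length (dims g) = k"
    using fg by (simp_all add: tensors_def)
  then show "length (dims (tensor_sum f g)) = k" "length (dims (tensor_sum g f)) = k"
    by (simp_all add: dims_tensor_sum)
  fix "is" assume "is": "is \<in> indices (dims (tensor_sum f g))"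
  have lis: "length is = k" and lt: "\<And>l. l < k \<Longrightarrow> is ! l < dims f ! l + dims g ! l"
    using "is" len by (auto simp: indices_iff dims_tensor_sum)
  let ?js = "map (\<lambda>l. if is ! l < dims f ! l then dims g ! l + is ! l else is ! l - dims f ! l) [0..<k]"
  have "?js ! l < dims g ! l + dims f ! l" if "l < k" for l
    using lt[OF that] that by auto
  then show js: "?js \<in> indices (dims (tensor_sum g f))"
    using len by (simp add: indices_iff dims_tensor_sum)
  note E = entry_tensor_sum[OF len "is"] entry_tensor_sum[OF len(2) len(1) js]
  consider (low) "\<forall>l<k. is ! l < dims f ! l" | (high) "\<forall>l<k. dims f ! l \<le> is ! l"
    | (mixed) "\<not> (\<forall>l<k. is ! l < dims f ! l)" "\<not> (\<forall>l<k. dims f ! l \<le> is ! l)" by blast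
  then show "entry (tensor_sum f g) is = entry (tensor_sum g f) ?js"
  proof cases
    case low
    then have 1: "\<forall>l<k. dims g ! l \<le> ?js ! l" by simp
    then have 2: "\<not> (\<forall>l<k. ?js ! l < dims g ! l)" using k by (meson not_le)
    have "map (\<lambda>l. ?js ! l - dims g ! l) [0..<k] = is"
      by (rule nth_equalityI) (use low lis in auto)
    then show ?thesis unfolding E if_P[OF low] if_not_P[OF 2] if_P[OF 1] by simp
  next
    case high
    then have 1: "?js = map (\<lambda>l. is ! l - dims f ! l) [0..<k]"
      by (intro map_cong refl) (auto simp: leD)
    have 2: "\<forall>l<k. ?js ! l < dims g ! l"
      using high lt by (auto simp: less_diff_conv2 add.commute)
    have 3: "\<not> (\<forall>l<k. is ! l < dims f ! l)" using high k by (meson not_le)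
    show ?thesis unfolding E if_not_P[OF 3] if_P[OF high] if_P[OF 2] unfolding 1 ..
  next
    case mixed
    then obtain l m where lm: "l < k" "\<not> is ! l < dims f ! l" "m < k" "is ! m < dims f ! m"
      by (auto simp: not_le)
    then have "\<not> ?js ! m < dims g ! m" "\<not> dims g ! l \<le> ?js ! l"
      using lt[of l] by auto
    then have js: "\<not> (\<forall>l<k. ?js ! l < dims g ! l)" "\<not> (\<forall>l<k. dims g ! l \<le> ?js ! l)"
      using lm by blast+
    show ?thesis unfolding E if_not_P[OF mixed(1)] if_not_P[OF mixed(2)] if_not_P[OF js(1)] if_not_P[OF js(2)] ..
  qed
qed

lemma index_div_mod_less:
  fixes i d e :: nat
  assumes "i < d * e"
  shows "i div e < d" "i mod e < e"
  using assms by (auto simp: less_mult_imp_div_less intro!: mod_less_divisor) (cases e; simp)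

lemma indices_div_mod:
  fixes f g :: "'a::times tensor"
  assumes len: "length (dims f) = k" "length (dims g) = k"
    and "is": "is \<in> indices (dims (tensor_prod f g))"
  shows "map (\<lambda>l. is ! l div dims g ! l) [0..<k] \<in> indices (dims f)"
    "map (\<lambda>l. is ! l mod dims g ! l) [0..<k] \<in> indices (dims g)"
proof -
  have lt: "is ! l < dims f ! l * dims g ! l" if "l < k" for l
    using that len "is" by (simp add: indices_iff dims_tensor_prod)
  then show "map (\<lambda>l. is ! l div dims g ! l) [0..<k] \<in> indices (dims f)"
    "map (\<lambda>l. is ! l mod dims g ! l) [0..<k] \<in> indices (dims g)"
    using len index_div_mod_less[OF lt] by (simp_all add: indices_iff)
qed

text \<open>An index is a two-digit number in mixed radix, and \<open>\<sigma>\<close> exchanges its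
  digits.\<close>

lemma tensor_prod_commute:
  fixes f g :: "'a::comm_semiring_1 tensor"
  assumes fg: "f \<in> tensors k" "g \<in> tensors k"
  shows "restricts (tensor_prod f g) (tensor_prod g f)"
proof (rule restricts_reindex[where k = k and
      \<sigma> = "\<lambda>l i. (i mod dims g ! l) * dims f ! l + i div dims g ! l"])
  have len: "length (dims f) = k" "length (dims g) = k"
    using fg by (simp_all add: tensors_def)
  then show "length (dims (tensor_prod f g)) = k" "length (dims (tensor_prod g f)) = k"
    by (simp_all add: dims_tensor_prod)
  fix "is" assume "is": "is \<in> indices (dims (tensor_prod f g))"
  have lt: "is ! l < dims f ! l * dims g ! l" if "l < k" for l
    using that len "is" by (simp add: indices_iff dims_tensor_prod)
  note dm = index_div_mod_less[OF lt]
  let ?js = "map (\<lambda>l. (is ! l mod dims g ! l) * dims f ! l + is ! l div dims g ! l) [0..<k]"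
  show js: "?js \<in> indices (dims (tensor_prod g f))"
    using len dm by (auto simp: indices_iff dims_tensor_prod intro!: mult_add_less)
  have "map (\<lambda>l. ?js ! l div dims f ! l) [0..<k] = map (\<lambda>l. is ! l mod dims g ! l) [0..<k]"
    "map (\<lambda>l. ?js ! l mod dims f ! l) [0..<k] = map (\<lambda>l. is ! l div dims g ! l) [0..<k]"
    using dm by (simp_all add: mult_add_div_mod)
  then show "entry (tensor_prod f g) is = entry (tensor_prod g f) ?js"
    unfolding entry_tensor_prod[OF len "is"] entry_tensor_prod[OF len(2) len(1) js]
    by (simp only: mult.commute)
qed

lemma tensor_sum_assoc:
  fixes f g h :: "'a::comm_semiring_1 tensor"
  assumes fgh: "f \<in> tensors k" "g \<in> tensors k" "h \<in> tensors k"
  shows "tensor_sum (tensor_sum f g) h = tensor_sum f (tensor_sum g h)"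
proof (rule tensor_eqI)
  have len: "length (dims f) = k" "length (dims g) = k" "length (dims h) = k"
    using fgh by (simp_all add: tensors_def)
  have len2: "length (dims (tensor_sum f g)) = k" "length (dims (tensor_sum g h)) = k"
    using len by (simp_all add: dims_tensor_sum)
  have dims: "dims (tensor_sum f g) ! l = dims f ! l + dims g ! l"
    "dims (tensor_sum g h) ! l = dims g ! l + dims h ! l" if "l < k" for l
    using len that by (simp_all add: dims_tensor_sum)
  show dims_eq: "dims (tensor_sum (tensor_sum f g) h) = dims (tensor_sum f (tensor_sum g h))"
    by (rule nth_equalityI) (simp_all add: dims_tensor_sum len add.assoc)
  fix "is" assume is2: "is \<in> indices (dims (tensor_sum f (tensor_sum g h)))"
  then have is1: "is \<in> indices (dims (tensor_sum (tensor_sum f g) h))" by (simp add: dims_eq)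
  have lis: "length is = k" and lt: "\<And>l. l < k \<Longrightarrow> is ! l < dims f ! l + (dims g ! l + dims h ! l)"
    using is2 len by (auto simp: indices_iff dims_tensor_sum)
  let ?s = "map (\<lambda>l. is ! l - dims f ! l) [0..<k]"
  have fg: "is \<in> indices (dims (tensor_sum f g))" if "\<forall>l<k. is ! l < dims (tensor_sum f g) ! l"
    using that lis len2 by (simp add: indices_iff)
  have gh: "?s \<in> indices (dims (tensor_sum g h))" if "\<forall>l<k. dims f ! l \<le> is ! l"
    using that lt len2 by (auto simp: indices_iff dims less_diff_conv2 add.commute)
  note E1 = entry_tensor_sum[OF len2(1) len(3) is1] and E2 = entry_tensor_sum[OF len(1) len2(2) is2]
    and Efg = entry_tensor_sum[OF len(1,2) fg] and Egh = entry_tensor_sum[OF len(2,3) gh]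
  consider (low) "\<forall>l<k. is ! l < dims f ! l" | (high) "\<forall>l<k. dims f ! l \<le> is ! l" "\<not> (\<forall>l<k. is ! l < dims f ! l)"
    | (mixed) "\<not> (\<forall>l<k. is ! l < dims f ! l)" "\<not> (\<forall>l<k. dims f ! l \<le> is ! l)" by blast
  then show "entry (tensor_sum (tensor_sum f g) h) is = entry (tensor_sum f (tensor_sum g h)) is"
  proof cases
    case low
    then have "\<forall>l<k. is ! l < dims (tensor_sum f g) ! l" by (simp add: dims trans_less_add1)
    then show ?thesis unfolding E1 E2 using low Efg by simp
  next
    case high
    have lt_iff: "(\<forall>l<k. is ! l < dims (tensor_sum f g) ! l) \<longleftrightarrow> (\<forall>l<k. ?s ! l < dims g ! l)"
      using high(1) by (auto simp: dims less_diff_conv2 add.commute)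
    have ge_iff: "(\<forall>l<k. dims (tensor_sum f g) ! l \<le> is ! l) \<longleftrightarrow> (\<forall>l<k. dims g ! l \<le> ?s ! l)"
      using high(1) by (auto simp: dims le_diff_conv2 add.commute)
    have shift: "map (\<lambda>l. is ! l - dims (tensor_sum f g) ! l) [0..<k] = map (\<lambda>l. ?s ! l - dims g ! l) [0..<k]"
      by (simp add: dims)
    have "entry (tensor_sum f (tensor_sum g h)) is = entry (tensor_sum g h) ?s"
      unfolding E2 if_not_P[OF high(2)] if_P[OF high(1)] ..
    moreover have "entry (tensor_sum f g) is = entry g ?s" if "\<forall>l<k. is ! l < dims (tensor_sum f g) ! l"
      unfolding Efg[OF that] if_not_P[OF high(2)] if_P[OF high(1)] ..
    ultimately show ?thesis
      unfolding E1 Egh[OF high(1)] lt_iff[symmetric] ge_iff[symmetric] shift[symmetric] by auto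
  next
    case mixed
    have "\<not> (\<forall>l<k. dims (tensor_sum f g) ! l \<le> is ! l)"
      using mixed(2) by (auto simp: dims)
    moreover have "entry (tensor_sum f g) is = 0" if "\<forall>l<k. is ! l < dims (tensor_sum f g) ! l"
      unfolding Efg[OF that] if_not_P[OF mixed(1)] if_not_P[OF mixed(2)] ..
    ultimately show ?thesis unfolding E1 E2 if_not_P[OF mixed(1)] if_not_P[OF mixed(2)] by auto
  qed
qed

lemma tensor_prod_assoc:
  fixes f g h :: "'a::comm_semiring_1 tensor"
  assumes fgh: "f \<in> tensors k" "g \<in> tensors k" "h \<in> tensors k"
  shows "tensor_prod (tensor_prod f g) h = tensor_prod f (tensor_prod g h)"
proof (rule tensor_eqI)
  have len: "length (dims f) = k" "length (dims g) = k" "length (dims h) = k"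
    using fgh by (simp_all add: tensors_def)
  have len2: "length (dims (tensor_prod f g)) = k" "length (dims (tensor_prod g h)) = k"
    using len by (simp_all add: dims_tensor_prod)
  have dims: "dims (tensor_prod g h) ! l = dims g ! l * dims h ! l" if "l < k" for l
    using len that by (simp_all add: dims_tensor_prod)
  show dims_eq: "dims (tensor_prod (tensor_prod f g) h) = dims (tensor_prod f (tensor_prod g h))"
    by (rule nth_equalityI) (simp_all add: dims_tensor_prod len mult.assoc)
  fix "is" assume is2: "is \<in> indices (dims (tensor_prod f (tensor_prod g h)))"
  then have is1: "is \<in> indices (dims (tensor_prod (tensor_prod f g) h))" by (simp add: dims_eq)
  let ?q = "map (\<lambda>l. is ! l div dims h ! l) [0..<k]"
    and ?r = "map (\<lambda>l. is ! l mod dims (tensor_prod g h) ! l) [0..<k]"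
  have 1: "entry (tensor_prod (tensor_prod f g) h) is = (entry f (map (\<lambda>l. ?q ! l div dims g ! l) [0..<k])
      * entry g (map (\<lambda>l. ?q ! l mod dims g ! l) [0..<k])) * entry h (map (\<lambda>l. is ! l mod dims h ! l) [0..<k])"
    unfolding entry_tensor_prod[OF len2(1) len(3) is1]
      entry_tensor_prod[OF len(1,2) indices_div_mod(1)[OF len2(1) len(3) is1]] ..
  have 2: "entry (tensor_prod f (tensor_prod g h)) is = entry f (map (\<lambda>l. is ! l div dims (tensor_prod g h) ! l) [0..<k])
      * (entry g (map (\<lambda>l. ?r ! l div dims h ! l) [0..<k]) * entry h (map (\<lambda>l. ?r ! l mod dims h ! l) [0..<k]))"
    unfolding entry_tensor_prod[OF len(1) len2(2) is2]
      entry_tensor_prod[OF len(2,3) indices_div_mod(2)[OF len(1) len2(2) is2]] ..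
  have A: "map (\<lambda>l. is ! l div dims (tensor_prod g h) ! l) [0..<k] = map (\<lambda>l. ?q ! l div dims g ! l) [0..<k]"
    by (simp add: dims mult.commute[of "dims g ! _"] div_mult2_eq)
  have B: "map (\<lambda>l. ?r ! l div dims h ! l) [0..<k] = map (\<lambda>l. ?q ! l mod dims g ! l) [0..<k]"
    "map (\<lambda>l. ?r ! l mod dims h ! l) [0..<k] = map (\<lambda>l. is ! l mod dims h ! l) [0..<k]"
  proof -
    have pos: "dims h ! l > 0" if "l < k" for l
      using is1 len len2 that by (cases "dims h ! l") (auto simp: indices_iff dims_tensor_prod)
    have r: "?r ! l = (is ! l div dims h ! l mod dims g ! l) * dims h ! l + is ! l mod dims h ! l" if "l < k" for l
      using that by (simp add: dims mult.commute[of "dims g ! _"] mod_mult2_eq)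
    show "map (\<lambda>l. ?r ! l div dims h ! l) [0..<k] = map (\<lambda>l. ?q ! l mod dims g ! l) [0..<k]"
      by (intro map_cong refl) (simp add: r mult_add_div_mod pos del: nth_map nth_map_upt, simp)
    show "map (\<lambda>l. ?r ! l mod dims h ! l) [0..<k] = map (\<lambda>l. is ! l mod dims h ! l) [0..<k]"
      by (intro map_cong refl) (simp add: r mult_add_div_mod pos del: nth_map nth_map_upt)
  qed
  show "entry (tensor_prod (tensor_prod f g) h) is = entry (tensor_prod f (tensor_prod g h)) is"
    unfolding 1 2 A B by (rule mult.assoc)
qed

text \<open>This is an equality of arrays because the left factor supplies the leading digit of an
  index: the blocks of \<open>f\<close> and \<open>g\<close> stay contiguous after multiplication by
  \<open>h\<close>. With the sum as right factor, a renumbering would intervene.\<close>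

lemma tensor_prod_distrib:
  fixes f g h :: "'a::comm_semiring_1 tensor"
  assumes fgh: "f \<in> tensors k" "g \<in> tensors k" "h \<in> tensors k"
  shows "tensor_prod (tensor_sum f g) h = tensor_sum (tensor_prod f h) (tensor_prod g h)"
proof (rule tensor_eqI)
  have len: "length (dims f) = k" "length (dims g) = k" "length (dims h) = k"
    using fgh by (simp_all add: tensors_def)
  have len2: "length (dims (tensor_sum f g)) = k" "length (dims (tensor_prod f h)) = k"
    "length (dims (tensor_prod g h)) = k"
    using len by (simp_all add: dims_tensor_sum dims_tensor_prod)
  have dims: "dims (tensor_prod f h) ! l = dims f ! l * dims h ! l" if "l < k" for l
    using len that by (simp add: dims_tensor_prod)
  show dims_eq: "dims (tensor_prod (tensor_sum f g) h) = dims (tensor_sum (tensor_prod f h) (tensor_prod g h))"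
    by (rule nth_equalityI) (simp_all add: dims_tensor_prod dims_tensor_sum len distrib_right)
  fix "is" assume is2: "is \<in> indices (dims (tensor_sum (tensor_prod f h) (tensor_prod g h)))"
  then have is1: "is \<in> indices (dims (tensor_prod (tensor_sum f g) h))" by (simp add: dims_eq)
  have lis: "length is = k" and lt: "\<And>l. l < k \<Longrightarrow> is ! l < dims f ! l * dims h ! l + dims g ! l * dims h ! l"
    using is2 len by (auto simp: indices_iff dims_tensor_sum dims_tensor_prod)
  have pos: "dims h ! l > 0" if "l < k" for l
    using lt[OF that] by (cases "dims h ! l") auto
  let ?q = "map (\<lambda>l. is ! l div dims h ! l) [0..<k]" and ?r = "map (\<lambda>l. is ! l mod dims h ! l) [0..<k]"
    and ?s = "map (\<lambda>l. is ! l - dims (tensor_prod f h) ! l) [0..<k]"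
  have lt_iff: "(\<forall>l<k. is ! l < dims (tensor_prod f h) ! l) \<longleftrightarrow> (\<forall>l<k. ?q ! l < dims f ! l)"
    using pos by (auto simp: dims div_less_iff_less_mult)
  have ge_iff: "(\<forall>l<k. dims (tensor_prod f h) ! l \<le> is ! l) \<longleftrightarrow> (\<forall>l<k. dims f ! l \<le> ?q ! l)"
    using pos by (auto simp: dims less_eq_div_iff_mult_less_eq)
  have L: "entry (tensor_prod (tensor_sum f g) h) is =
    (if \<forall>l<k. ?q ! l < dims f ! l then entry f ?q
     else if \<forall>l<k. dims f ! l \<le> ?q ! l then entry g (map (\<lambda>l. ?q ! l - dims f ! l) [0..<k]) else 0) * entry h ?r"
    unfolding entry_tensor_prod[OF len2(1) len(3) is1]
      entry_tensor_sum[OF len(1,2) indices_div_mod(1)[OF len2(1) len(3) is1]] ..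
  have R1: "entry (tensor_prod f h) is = entry f ?q * entry h ?r" if "\<forall>l<k. is ! l < dims (tensor_prod f h) ! l"
    using that lis len2 by (intro entry_tensor_prod len) (simp add: indices_iff)
  have R2: "entry (tensor_prod g h) ?s = entry g (map (\<lambda>l. ?q ! l - dims f ! l) [0..<k]) * entry h ?r"
    if ge: "\<forall>l<k. dims (tensor_prod f h) ! l \<le> is ! l"
  proof -
    have "?s \<in> indices (dims (tensor_prod g h))"
      using lt ge len by (auto simp: indices_iff dims dims_tensor_prod less_diff_conv2 add.commute)
    note entry_tensor_prod[OF len(2,3) this]
    moreover have "?s ! l div dims h ! l = ?q ! l - dims f ! l" "?s ! l mod dims h ! l = ?r ! l" if "l < k" for l
    proof -
      have "?q ! l = (?s ! l + dims f ! l * dims h ! l) div dims h ! l"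
        "?r ! l = (?s ! l + dims f ! l * dims h ! l) mod dims h ! l"
        using ge that by (simp_all add: dims)
      then have "?q ! l = ?s ! l div dims h ! l + dims f ! l" "?r ! l = ?s ! l mod dims h ! l"
        using pos[OF that] by (simp_all del: nth_map nth_map_upt)
      then show "?s ! l div dims h ! l = ?q ! l - dims f ! l" "?s ! l mod dims h ! l = ?r ! l" by simp_all
    qed
    then have "map (\<lambda>l. ?s ! l div dims h ! l) [0..<k] = map (\<lambda>l. ?q ! l - dims f ! l) [0..<k]"
      "map (\<lambda>l. ?s ! l mod dims h ! l) [0..<k] = ?r"
      by simp_all
    ultimately show ?thesis by simp
  qed
  show "entry (tensor_prod (tensor_sum f g) h) is = entry (tensor_sum (tensor_prod f h) (tensor_prod g h)) is"
    unfolding L entry_tensor_sum[OF len2(2,3) is2] unfolding lt_iff ge_iff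
    using R1[unfolded lt_iff] R2[unfolded ge_iff] by auto
qed

text \<open>Positive order matters: for \<open>k = 0\<close> the empty index counts as lying in the
  first block, and the sum would be \<open>zero_tensor 0\<close>.\<close>

lemma tensor_sum_zero:
  fixes f :: "'a::comm_semiring_1 tensor"
  assumes k: "k > 0" and f: "f \<in> tensors k"
  shows "tensor_sum (zero_tensor k) f = f"
proof (rule tensor_eqI)
  have len: "length (dims (zero_tensor k)) = k" "length (dims f) = k"
    using f by (simp_all add: tensors_def zero_tensor_def)
  show d: "dims (tensor_sum (zero_tensor k) f) = dims f"
    by (rule nth_equalityI) (use len in \<open>simp_all add: dims_tensor_sum zero_tensor_def\<close>)
  fix "is" assume "is": "is \<in> indices (dims f)"
  then have "map (\<lambda>l. is ! l - 0) [0..<k] = is"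
    using len by (simp add: indices_iff map_nth_id)
  moreover have "map (\<lambda>l. is ! l - dims (zero_tensor k :: 'a tensor) ! l) [0..<k] = map (\<lambda>l. is ! l - 0) [0..<k]"
    by (intro map_cong refl) (simp add: zero_tensor_def)
  ultimately have "map (\<lambda>l. is ! l - dims (zero_tensor k :: 'a tensor) ! l) [0..<k] = is"
    by simp
  then show "entry (tensor_sum (zero_tensor k) f) is = entry f is"
    using entry_tensor_sum[OF len, of "is"] "is" k unfolding d by (auto simp: zero_tensor_def)
qed

lemma tensor_prod_zero:
  assumes k: "k > 0" and f: "f \<in> tensors k"
  shows "tensor_prod (zero_tensor k) f = zero_tensor k"
proof (rule tensor_eqI)
  show "dims (tensor_prod (zero_tensor k) f) = dims (zero_tensor k)"
    by (rule nth_equalityI) (use f in \<open>simp_all add: dims_tensor_prod zero_tensor_def tensors_def\<close>)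
qed (simp add: indices_zero_tensor k)

lemma tensor_prod_unit:
  fixes f :: "'a::comm_semiring_1 tensor"
  assumes f: "f \<in> tensors k"
  shows "tensor_prod (unit_tensor k) f = f"
proof (rule tensor_eqI)
  have len: "length (dims (unit_tensor k)) = k" "length (dims f) = k"
    using f by (simp_all add: tensors_def unit_tensor_def)
  show d: "dims (tensor_prod (unit_tensor k) f) = dims f"
    by (rule nth_equalityI) (use len in \<open>simp_all add: dims_tensor_prod unit_tensor_def\<close>)
  fix "is" assume "is": "is \<in> indices (dims f)"
  have is1: "is \<in> indices (dims (tensor_prod (unit_tensor k) f))"
    using "is" unfolding d .
  have "map (\<lambda>l. is ! l mod dims f ! l) [0..<k] = is"
    by (rule nth_equalityI) (use "is" len in \<open>simp_all add: indices_iff\<close>)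
  moreover have "entry (unit_tensor k :: 'a tensor) (map (\<lambda>l. is ! l div dims f ! l) [0..<k]) = 1"
    using indices_div_mod(1)[OF len is1] by (simp add: unit_tensor_def)
  ultimately show "entry (tensor_prod (unit_tensor k) f) is = entry f is"
    using entry_tensor_prod[OF len is1] by simp
qed

section \<open>Zero and diagonal tensors as bounds\<close>

lemma zero_tensor_restricts:
  assumes "k > 0" "f \<in> tensors k"
  shows "restricts (zero_tensor k) f"
  using assms by (simp add: restricts_iff indices_zero_tensor) (simp add: tensors_def zero_tensor_def)

lemma not_unit_restricts_zero:
  assumes "k > 0"
  shows "\<not> restricts (unit_tensor k :: 'a::comm_semiring_1 tensor) (zero_tensor k)"
proof
  assume "restricts (unit_tensor k :: 'a tensor) (zero_tensor k)"
  then have "entry (unit_tensor k :: 'a tensor) is = 0" if "is \<in> indices (dims (unit_tensor k :: 'a tensor))" for "is"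
    using that assms by (auto simp: restricts_iff indices_zero_tensor)
  moreover have "replicate k 0 \<in> indices (dims (unit_tensor k :: 'a tensor))"
    by (simp add: unit_tensor_def indices_iff)
  moreover have "entry (unit_tensor k :: 'a tensor) (replicate k 0) = 1"
    by (simp add: unit_tensor_def indices_iff)
  ultimately show False by fastforce
qed

text \<open>The tensor commonly written \<langle>n\<rangle>, the sum of the k-th tensor powers of
  the n basis vectors; it plays the role of the natural number n.\<close>

definition diag_tensor :: "nat \<Rightarrow> nat \<Rightarrow> 'a::zero_neq_one tensor" where
  "diag_tensor k n = tensor (replicate k n) (\<lambda>is. if \<forall>l<k. is ! l = is ! 0 then 1 else 0)"

lemma diag_tensor_0: "k > 0 \<Longrightarrow> diag_tensor k 0 = zero_tensor k"
  by (rule tensor_eqI) (simp_all add: diag_tensor_def zero_tensor_def indices_iff)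

lemma diag_tensor_Suc:
  assumes k: "k > 0"
  shows "tensor_sum (unit_tensor k) (diag_tensor k n) = (diag_tensor k (Suc n) :: 'a::comm_semiring_1 tensor)"
proof (rule tensor_eqI)
  have len: "length (dims (unit_tensor k :: 'a tensor)) = k" "length (dims (diag_tensor k n :: 'a tensor)) = k"
    by (simp_all add: unit_tensor_def diag_tensor_def)
  show d: "dims (tensor_sum (unit_tensor k) (diag_tensor k n)) = dims (diag_tensor k (Suc n) :: 'a tensor)"
    by (rule nth_equalityI) (simp_all add: dims_tensor_sum unit_tensor_def diag_tensor_def)
  fix "is" assume "is": "is \<in> indices (dims (diag_tensor k (Suc n) :: 'a tensor))"
  have is1: "is \<in> indices (dims (tensor_sum (unit_tensor k) (diag_tensor k n :: 'a tensor)))"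
    using "is" unfolding d .
  have lis: "length is = k" "\<And>l. l < k \<Longrightarrow> is ! l < Suc n"
    using "is" by (auto simp: diag_tensor_def indices_iff)
  have dims: "dims (unit_tensor k :: 'a tensor) ! l = 1" if "l < k" for l
    using that by (simp add: unit_tensor_def)
  have R: "entry (diag_tensor k (Suc n) :: 'a tensor) is = (if \<forall>l<k. is ! l = is ! 0 then 1 else 0)"
    using "is" by (simp add: diag_tensor_def)
  note E = entry_tensor_sum[OF len is1]
  consider (low) "\<forall>l<k. is ! l < 1" | (high) "\<forall>l<k. 1 \<le> is ! l"
    | (mixed) "\<not> (\<forall>l<k. is ! l < 1)" "\<not> (\<forall>l<k. 1 \<le> is ! l)" by blast
  then show "entry (tensor_sum (unit_tensor k) (diag_tensor k n)) is = entry (diag_tensor k (Suc n) :: 'a tensor) is"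
  proof cases
    case low
    then have "is \<in> indices (replicate k 1)" using lis by (simp add: indices_iff)
    then have "entry (unit_tensor k :: 'a tensor) is = 1" by (simp add: unit_tensor_def)
    then show ?thesis unfolding E R using low k by (auto simp: dims)
  next
    case high
    let ?s = "map (\<lambda>l. is ! l - dims (unit_tensor k :: 'a tensor) ! l) [0..<k]"
    have "is ! l - 1 < n" if "l < k" for l using lis(2)[OF that] high that by fastforce
    then have s: "?s \<in> indices (replicate k n)" by (simp add: indices_iff dims)
    have "(\<forall>l<k. ?s ! l = ?s ! 0) \<longleftrightarrow> (\<forall>l<k. is ! l = is ! 0)"
    proof -
      have "?s ! l = ?s ! 0 \<longleftrightarrow> is ! l = is ! 0" if "l < k" for l
        using high that k dims by (auto simp: eq_diff_iff)
      then show ?thesis by blast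
    qed
    then have "entry (diag_tensor k n :: 'a tensor) ?s = (if \<forall>l<k. is ! l = is ! 0 then 1 else 0)"
      using s by (simp add: diag_tensor_def del: nth_map)
    moreover have lt: "\<not> (\<forall>l<k. is ! l < dims (unit_tensor k :: 'a tensor) ! l)"
      using high k dims by (metis not_le)
    moreover have ge: "\<forall>l<k. dims (unit_tensor k :: 'a tensor) ! l \<le> is ! l"
      using high dims by simp
    ultimately show ?thesis unfolding E R if_not_P[OF lt] if_P[OF ge] by blast
  next
    case mixed
    then have neq: "\<not> (\<forall>l<k. is ! l = is ! 0)" by (metis not_le)
    have "\<not> (\<forall>l<k. is ! l < dims (unit_tensor k :: 'a tensor) ! l)"
      "\<not> (\<forall>l<k. dims (unit_tensor k :: 'a tensor) ! l \<le> is ! l)"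
      using mixed dims by auto
    then show ?thesis unfolding E R if_not_P[OF neq] by (simp only: if_False)
  qed
qed

text \<open>A tensor is a sum of one rank-one tensor per coordinate, each a scalar times a product
  of basis vectors. This is the source of the bound by a natural number.\<close>

lemma restricts_diag_tensor:
  fixes f :: "'a::comm_semiring_1 tensor"
  assumes k: "k > 0" and f: "f \<in> tensors k"
  shows "restricts f (diag_tensor k (card (indices (dims f))))"
proof -
  define n where "n = card (indices (dims f))"
  have len: "length (dims f) = k" using f by (simp add: tensors_def)
  obtain e where e: "bij_betw e {..<n} (indices (dims f))"
    using ex_bij_betw_nat_finite[OF finite_indices] unfolding n_def by (metis atLeast0LessThan)
  \<comment> \<open>In factor \<open>l\<close> the j-th basis vector goes to the one with number
    \<open>e j ! l\<close>. The scalar \<open>entry f (e j)\<close> may occur only once, so factor 0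
    carries it.\<close>
  define a where "a l i j = (if l = 0 then entry f (e j) else 1) * (if i = e j ! l then 1 else 0)" for l i j
  have "entry f is = (\<Sum>js\<in>indices (replicate k n). (\<Prod>l<k. a l (is ! l) (js ! l))
      * (if \<forall>l<k. js ! l = js ! 0 then 1 else 0))" if "is": "is \<in> indices (dims f)" for "is"
  proof -
    have prod: "(\<Prod>l<k. a l (is ! l) j) = (if j = the_inv_into {..<n} e is then entry f is else 0)" if j: "j < n" for j
    proof -
      have ej: "e j \<in> indices (dims f)" using e j by (auto simp: bij_betw_def)
      have "(\<Prod>l<k. a l (is ! l) j) = (\<Prod>l<k. if l = 0 then entry f (e j) else 1) * (\<Prod>l<k. if is ! l = e j ! l then 1 else 0)"
        unfolding a_def by (rule prod.distrib)
      also have "(\<Prod>l<k. if l = 0 then entry f (e j) else 1) = entry f (e j)"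
        using k by (subst prod.delta) auto
      also have "(\<Prod>l<k. if is ! l = e j ! l then 1 else 0) = (if is = e j then 1 else (0::'a))"
        unfolding prod_if_one_zero using "is" ej len
        by (auto simp: indices_iff intro!: nth_equalityI)
      also have "is = e j \<longleftrightarrow> j = the_inv_into {..<n} e is"
        using e j "is" by (metis bij_betw_def f_the_inv_into_f_bij_betw lessThan_iff the_inv_into_f_f)
      finally show ?thesis
        using e "is" by (auto simp: f_the_inv_into_f_bij_betw)
    qed
    have inv: "the_inv_into {..<n} e is < n"
      using e "is" bij_betw_the_inv_into bij_betwE by blast
    \<comment> \<open>Only the constant multi-indices \<open>replicate k j\<close> meet a nonzero
      entry of the diagonal tensor.\<close>
    have "(\<Sum>js\<in>indices (replicate k n). (\<Prod>l<k. a l (is ! l) (js ! l)) * (if \<forall>l<k. js ! l = js ! 0 then 1 else 0))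
      = (\<Sum>js\<in>(\<lambda>j. replicate k j) ` {..<n}. (\<Prod>l<k. a l (is ! l) (js ! l)) * (if \<forall>l<k. js ! l = js ! 0 then 1 else 0))"
    proof (rule sum.mono_neutral_right)
      show "(\<lambda>j. replicate k j) ` {..<n} \<subseteq> indices (replicate k n)" by (auto simp: indices_iff)
      show "\<forall>js\<in>indices (replicate k n) - (\<lambda>j. replicate k j) ` {..<n}.
          (\<Prod>l<k. a l (is ! l) (js ! l)) * (if \<forall>l<k. js ! l = js ! 0 then 1 else 0) = 0"
      proof
        fix js assume js: "js \<in> indices (replicate k n) - (\<lambda>j. replicate k j) ` {..<n}"
        have "\<not> (\<forall>l<k. js ! l = js ! 0)"
        proof
          assume *: "\<forall>l<k. js ! l = js ! 0"
          have "length js = k" using js by (simp add: indices_iff)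
          then have "js = replicate k (js ! 0)"
            using * by (metis length_replicate nth_equalityI nth_replicate)
          moreover have "js ! 0 < n" using js k by (auto simp: indices_iff)
          ultimately show False using js by blast
        qed
        then show "(\<Prod>l<k. a l (is ! l) (js ! l)) * (if \<forall>l<k. js ! l = js ! 0 then 1 else 0) = 0"
            by (simp only: if_False mult_zero_right)
      qed
    qed (rule finite_indices)
    also have "\<dots> = (\<Sum>j<n. \<Prod>l<k. a l (is ! l) j)"
    proof (subst sum.reindex)
      show "inj_on (\<lambda>j. replicate k j) {..<n}"
        using k by (auto simp: inj_on_def)
    qed (use k in \<open>simp\<close>)
    also have "\<dots> = (\<Sum>j<n. if j = the_inv_into {..<n} e is then entry f is else 0)"
      using prod by (intro sum.cong) auto
    also have "\<dots> = entry f is" using inv by simp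
    finally show ?thesis by simp
  qed
  then have "\<forall>is\<in>indices (dims f). entry f is = (\<Sum>js\<in>indices (dims (diag_tensor k n :: 'a tensor)).
      (\<Prod>l<length (dims (diag_tensor k n :: 'a tensor)). a l (is ! l) (js ! l)) * entry (diag_tensor k n) js)"
    by (simp add: diag_tensor_def)
  moreover have "length (dims f) = length (dims (diag_tensor k n :: 'a tensor))"
    using len by (simp add: diag_tensor_def)
  ultimately show ?thesis
    unfolding restricts_iff n_def by blast
qed

section \<open>The semiring of tensors\<close>

text \<open>
  Tensors of a fixed order form a commutative semiring only up to mutual restriction. The order is
  not available to the type system, so the quotient is taken for all positive orders at once.
\<close>

definition family_equiv :: "(nat \<Rightarrow> 'a::comm_semiring_1 tensor) \<Rightarrow> (nat \<Rightarrow> 'a tensor) \<Rightarrow> bool" where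
  "family_equiv F G \<longleftrightarrow>
    (\<forall>k>0. F k \<in> tensors k \<and> G k \<in> tensors k \<and> restricts (F k) (G k) \<and> restricts (G k) (F k))"

text \<open>The equivalence is partial: a family whose member at some positive \<open>k\<close> is
  not of order \<open>k\<close> is not related even to itself.\<close>

lemma part_equivp_family_equiv: "part_equivp family_equiv"
proof (rule part_equivpI)
  show "\<exists>F :: nat \<Rightarrow> 'a tensor. family_equiv F F"
    by (rule exI[of _ zero_tensor]) (simp add: family_equiv_def zero_tensor_in_tensors restricts_refl)
  show "symp (family_equiv :: (nat \<Rightarrow> 'a tensor) \<Rightarrow> _)"
    by (auto simp: symp_def family_equiv_def)
  show "transp (family_equiv :: (nat \<Rightarrow> 'a tensor) \<Rightarrow> _)"
    unfolding transp_def family_equiv_def using restricts_trans by blast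
qed

quotient_type (overloaded) 'a tensor_family = "nat \<Rightarrow> 'a::comm_semiring_1 tensor" / partial: family_equiv
  by (rule part_equivp_family_equiv)

lemma family_equiv_eqI:
  assumes "\<And>k. k > 0 \<Longrightarrow> F k \<in> tensors k" "\<And>k. k > 0 \<Longrightarrow> F k = G k"
  shows "family_equiv F G"
  using assms by (simp add: family_equiv_def restricts_refl)

lemmas tensor_closure = tensor_sum_in_tensors tensor_prod_in_tensors unit_tensor_in_tensors
  zero_tensor_in_tensors

lemma family_equiv_sum:
  assumes "family_equiv F F'" "family_equiv G G'"
  shows "family_equiv (\<lambda>k. tensor_sum (F k) (G k)) (\<lambda>k. tensor_sum (F' k) (G' k))"
  unfolding family_equiv_def
proof (intro allI impI)
  fix k :: nat assume k: "k > 0"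
  have "F k \<in> tensors k \<and> F' k \<in> tensors k \<and> restricts (F k) (F' k) \<and> restricts (F' k) (F k)"
    "G k \<in> tensors k \<and> G' k \<in> tensors k \<and> restricts (G k) (G' k) \<and> restricts (G' k) (G k)"
    using assms k by (auto simp only: family_equiv_def)
  then show "tensor_sum (F k) (G k) \<in> tensors k \<and> tensor_sum (F' k) (G' k) \<in> tensors k \<and>
      restricts (tensor_sum (F k) (G k)) (tensor_sum (F' k) (G' k)) \<and>
      restricts (tensor_sum (F' k) (G' k)) (tensor_sum (F k) (G k))"
    by (elim conjE) (intro conjI tensor_sum_in_tensors restricts_tensor_sum[where k = k] k; assumption)
qed

lemma family_equiv_prod:
  assumes "family_equiv F F'" "family_equiv G G'"
  shows "family_equiv (\<lambda>k. tensor_prod (F k) (G k)) (\<lambda>k. tensor_prod (F' k) (G' k))"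
  unfolding family_equiv_def
proof (intro allI impI)
  fix k :: nat assume k: "k > 0"
  have "F k \<in> tensors k \<and> F' k \<in> tensors k \<and> restricts (F k) (F' k) \<and> restricts (F' k) (F k)"
    "G k \<in> tensors k \<and> G' k \<in> tensors k \<and> restricts (G k) (G' k) \<and> restricts (G' k) (G k)"
    using assms k by (auto simp only: family_equiv_def)
  then show "tensor_prod (F k) (G k) \<in> tensors k \<and> tensor_prod (F' k) (G' k) \<in> tensors k \<and>
      restricts (tensor_prod (F k) (G k)) (tensor_prod (F' k) (G' k)) \<and>
      restricts (tensor_prod (F' k) (G' k)) (tensor_prod (F k) (G k))"
    by (elim conjE) (intro conjI tensor_prod_in_tensors restricts_tensor_prod[where k = k]; assumption)
qed

instantiation tensor_family :: (comm_semiring_1) comm_semiring_1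
begin

lift_definition zero_tensor_family :: "'a tensor_family" is zero_tensor
  by (simp add: family_equiv_def zero_tensor_in_tensors restricts_refl)

lift_definition one_tensor_family :: "'a tensor_family" is unit_tensor
  by (simp add: family_equiv_def unit_tensor_in_tensors restricts_refl)

lift_definition plus_tensor_family :: "'a tensor_family \<Rightarrow> 'a tensor_family \<Rightarrow> 'a tensor_family"
  is "\<lambda>F G k. tensor_sum (F k) (G k)"
  by (rule family_equiv_sum)

lift_definition times_tensor_family :: "'a tensor_family \<Rightarrow> 'a tensor_family \<Rightarrow> 'a tensor_family"
  is "\<lambda>F G k. tensor_prod (F k) (G k)"
  by (rule family_equiv_prod)

instance
proof
  fix a b c :: "'a tensor_family"
  have zero: "0 * a = 0" for a :: "'a tensor_family"
    by transfer (rule family_equiv_eqI; unfold family_equiv_def; metis tensor_prod_zero tensor_closure)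
  have commute: "a * b = b * a" for a b :: "'a tensor_family"
    by transfer (unfold family_equiv_def, metis tensor_prod_commute tensor_prod_in_tensors)
  show "a + b + c = a + (b + c)"
    by transfer (rule family_equiv_eqI; unfold family_equiv_def; metis tensor_sum_assoc tensor_closure)
  show "a + b = b + a"
    by transfer (unfold family_equiv_def, metis tensor_sum_commute tensor_sum_in_tensors)
  show "0 + a = a"
    by transfer (rule family_equiv_eqI; unfold family_equiv_def; metis tensor_sum_zero tensor_closure)
  show "a * b * c = a * (b * c)"
    by transfer (rule family_equiv_eqI; unfold family_equiv_def; metis tensor_prod_assoc tensor_closure)
  show "a * b = b * a" by (rule commute)
  show "1 * a = a"
    by transfer (rule family_equiv_eqI; unfold family_equiv_def; metis tensor_prod_unit tensor_closure)
  show "(a + b) * c = a * c + b * c"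
    by transfer (rule family_equiv_eqI; unfold family_equiv_def; metis tensor_prod_distrib tensor_closure)
  show "0 * a = 0" by (rule zero)
  show "a * 0 = 0" using zero[of a] commute[of a 0] by simp
  show "(0 :: 'a tensor_family) \<noteq> 1"
    by transfer (use not_unit_restricts_zero[of 1] in \<open>auto simp: family_equiv_def\<close>)
qed

end

text \<open>The conjunct \<open>k > 0\<close> makes this well defined on classes, since the
  equivalence says nothing about the member at 0.\<close>

lift_definition restricts_at :: "nat \<Rightarrow> 'a::comm_semiring_1 tensor_family \<Rightarrow> 'a tensor_family \<Rightarrow> bool"
  is "\<lambda>k F G. k > 0 \<and> restricts (F k) (G k)"
  unfolding family_equiv_def by (metis restricts_trans)

text \<open>Zero tensors at the other orders make this compatible with sums and products, but they
  also keep the image of \<open>unit_tensor k\<close> from being 1.\<close>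

definition embed :: "nat \<Rightarrow> 'a::comm_semiring_1 tensor \<Rightarrow> 'a tensor_family" where
  "embed k f = abs_tensor_family (\<lambda>j. if j = k then f else zero_tensor j)"

lemma family_equiv_embed:
  assumes "f \<in> tensors k"
  shows "family_equiv (\<lambda>j. if j = k then f else zero_tensor j) (\<lambda>j. if j = k then f else zero_tensor j)"
  using assms by (intro family_equiv_eqI) (auto intro: zero_tensor_in_tensors)

lemma embed_cong: "family_equiv F G \<Longrightarrow> abs_tensor_family F = abs_tensor_family G"
  by (rule Quotient_rel_abs[OF Quotient_tensor_family])

lemma restricts_at_embed:
  assumes "k > 0" "f \<in> tensors k" "g \<in> tensors k"
  shows "restricts_at k (embed k f) (embed k g) \<longleftrightarrow> restricts f g"
  unfolding embed_def restricts_at.abs_eq[OF family_equiv_embed[OF assms(2)] family_equiv_embed[OF assms(3)]]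
  using assms(1) by simp

lemma embed_sum:
  assumes "f \<in> tensors k" "g \<in> tensors k"
  shows "embed k (tensor_sum f g) = embed k f + embed k g"
  unfolding embed_def plus_tensor_family.abs_eq[OF family_equiv_embed[OF assms(1)] family_equiv_embed[OF assms(2)]]
  using assms by (intro embed_cong family_equiv_eqI)
    (auto simp: tensor_sum_zero zero_tensor_in_tensors intro: tensor_closure)

lemma embed_prod:
  assumes "f \<in> tensors k" "g \<in> tensors k"
  shows "embed k (tensor_prod f g) = embed k f * embed k g"
  unfolding embed_def times_tensor_family.abs_eq[OF family_equiv_embed[OF assms(1)] family_equiv_embed[OF assms(2)]]
  using assms by (intro embed_cong family_equiv_eqI)
    (auto simp: tensor_prod_zero zero_tensor_in_tensors intro: tensor_closure)

lemma family_equiv_unit: "family_equiv unit_tensor unit_tensor"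
  by (intro family_equiv_eqI unit_tensor_in_tensors refl)

lemma family_equiv_zero: "family_equiv zero_tensor zero_tensor"
  by (intro family_equiv_eqI zero_tensor_in_tensors refl)

lemma embed_zero: "embed k (zero_tensor k) = 0"
  unfolding embed_def zero_tensor_family.abs_eq
  by (intro embed_cong family_equiv_eqI) (auto intro: zero_tensor_in_tensors)

lemma restricts_at_embed_unit:
  assumes k: "k > 0"
  shows "restricts_at k (embed k (unit_tensor k)) 1" "restricts_at k 1 (embed k (unit_tensor k))"
  unfolding embed_def one_tensor_family.abs_eq
    restricts_at.abs_eq[OF family_equiv_embed[OF unit_tensor_in_tensors] family_equiv_unit]
    restricts_at.abs_eq[OF family_equiv_unit family_equiv_embed[OF unit_tensor_in_tensors]]
  using k by (simp_all add: restricts_refl)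

lemma ex_embed:
  assumes k: "k > 0"
  obtains f where "f \<in> tensors k" "restricts_at k x (embed k f)" "restricts_at k (embed k f) x"
proof (induction x rule: tensor_family.abs_induct)
  case (1 F)
  have F: "F k \<in> tensors k" using 1(1) k by (simp add: family_equiv_def)
  note E = family_equiv_embed[OF F]
  show ?case
  proof (rule 1(2)[OF F])
    show "restricts_at k (abs_tensor_family F) (embed k (F k))" "restricts_at k (embed k (F k)) (abs_tensor_family F)"
      unfolding embed_def restricts_at.abs_eq[OF 1(1) E] restricts_at.abs_eq[OF E 1(1)]
      using k by (simp_all add: restricts_refl)
  qed
qed

lemma zero_restricts_at:
  assumes k: "k > 0"
  shows "restricts_at k 0 x"
proof (induction x rule: tensor_family.abs_induct)
  case (1 F)
  show ?case
    unfolding zero_tensor_family.abs_eq restricts_at.abs_eq[OF family_equiv_zero 1]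
    using 1 k by (simp add: zero_tensor_restricts family_equiv_def)
qed

lemma diag_tensor_in_tensors: "diag_tensor k n \<in> tensors k"
  by (simp add: tensors_def diag_tensor_def)

lemma semiring_preorder_restricts_at:
  assumes k: "k > 0"
  shows "semiring_preorder (restricts_at k :: 'a::comm_semiring_1 tensor_family \<Rightarrow> _)"
proof -
  have refl: "restricts_at k x x" for x :: "'a tensor_family"
    using k by transfer (simp add: restricts_refl)
  have trans: "restricts_at k x z" if "restricts_at k x y" "restricts_at k y z" for x y z :: "'a tensor_family"
    using that by transfer (blast intro: restricts_trans)
  have add: "restricts_at k (x + z) (y + z)" if "restricts_at k x y" for x y z :: "'a tensor_family"
    using that by transfer (auto simp: family_equiv_def intro!: restricts_tensor_sum restricts_refl)
  show ?thesis
  proof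
    show "restricts_at k (x * z) (y * z)" if "restricts_at k x y" for x y z :: "'a tensor_family"
      using that by transfer (auto simp: family_equiv_def intro!: restricts_tensor_prod restricts_refl)
    show "restricts_at k 0 x" for x :: "'a tensor_family"
      by (rule zero_restricts_at[OF k])
    \<comment> \<open>The numeral \<open>of_nat n\<close> lives at every order, the embedded tensor
      at order \<open>k\<close> alone; \<open>restricts_at k\<close> does not see the
      difference.\<close>
    have diag: "restricts_at k (embed k (diag_tensor k n)) (of_nat n :: 'a tensor_family)" for n
    proof (induction n)
      case 0
      show ?case by (simp add: k diag_tensor_0 embed_zero refl)
    next
      case (Suc n)
      have "embed k (diag_tensor k (Suc n) :: 'a tensor) = embed k (unit_tensor k) + embed k (diag_tensor k n)"
        by (simp add: diag_tensor_Suc[OF k, symmetric] embed_sum unit_tensor_in_tensors diag_tensor_in_tensors)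
      moreover have "restricts_at k (embed k (unit_tensor k) + embed k (diag_tensor k n)) (1 + embed k (diag_tensor k n) :: 'a tensor_family)"
        by (intro add restricts_at_embed_unit k)
      moreover have "restricts_at k (1 + embed k (diag_tensor k n)) (1 + of_nat n :: 'a tensor_family)"
        using add[OF Suc, of 1] by (simp add: add.commute)
      ultimately show ?case using trans by simp
    qed
    show "\<exists>n. restricts_at k x (of_nat n)" for x :: "'a tensor_family"
    proof -
      obtain f where f: "f \<in> tensors k" "restricts_at k x (embed k f)" using ex_embed[OF k] .
      moreover have "restricts_at k (embed k f) (embed k (diag_tensor k (card (indices (dims f)))))"
        using restricts_diag_tensor[OF k f(1)] by (simp add: restricts_at_embed k f diag_tensor_in_tensors)
      ultimately show ?thesis using diag trans by blast
    qed
  qed (fact refl trans add)+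
qed

section \<open>Symmetric tensors\<close>

lemma sym_tensors_subset: "f \<in> sym_tensors k \<Longrightarrow> f \<in> tensors k"
  by (auto simp: sym_tensors_def tensors_def)

lemma sym_tensorsI:
  assumes "dims f = replicate k d"
    and "\<And>p is. p permutes {..<k} \<Longrightarrow> is \<in> indices (replicate k d) \<Longrightarrow>
      entry f (permute_list p is) = entry f is"
  shows "f \<in> sym_tensors k"
  using assms by (auto simp: sym_tensors_def)

lemma sym_tensors_dims:
  assumes "f \<in> sym_tensors k"
  obtains d where "dims f = replicate k d"
  using assms by (auto simp: sym_tensors_def)

lemma sym_tensors_entry:
  "f \<in> sym_tensors k \<Longrightarrow> p permutes {..<k} \<Longrightarrow> is \<in> indices (dims f) \<Longrightarrow>
    entry f (permute_list p is) = entry f is"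
  by (simp add: sym_tensors_def)

lemma permutes_less: "p permutes {..<k} \<Longrightarrow> l < k \<Longrightarrow> p l < k"
  using permutes_in_image[of p "{..<k}" l] by simp

lemma all_permutes:
  assumes "p permutes {..<k}"
  shows "(\<forall>l<k. P (p l)) \<longleftrightarrow> (\<forall>l<k. P l)"
proof -
  have "(\<forall>l\<in>p ` {..<k}. P l) \<longleftrightarrow> (\<forall>l\<in>{..<k}. P (p l))" by blast
  then show ?thesis using permutes_image[OF assms] by auto
qed

lemma nth_permute_list:
  "p permutes {..<k} \<Longrightarrow> length is = k \<Longrightarrow> l < k \<Longrightarrow> permute_list p is ! l = is ! p l"
  by (simp add: permute_list_nth)

lemma permute_list_in_indices:
  assumes "p permutes {..<k}" "is \<in> indices (replicate k d)"
  shows "permute_list p is \<in> indices (replicate k d)"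
  using assms by (auto simp: indices_iff nth_permute_list permutes_less)

lemma map_permute_list:
  assumes "p permutes {..<k}" "length is = k"
  shows "map (\<lambda>l. F (permute_list p is ! l)) [0..<k] = permute_list p (map (\<lambda>l. F (is ! l)) [0..<k])"
  by (rule nth_equalityI) (use assms in \<open>simp_all add: nth_permute_list permutes_less\<close>)

lemma tensor_sum_in_sym_tensors:
  fixes f g :: "'a::comm_semiring_1 tensor"
  assumes "f \<in> sym_tensors k" "g \<in> sym_tensors k"
  shows "tensor_sum f g \<in> sym_tensors k"
proof -
  obtain d where d: "dims f = replicate k d"
    using assms(1) by (rule sym_tensors_dims)
  note f = sym_tensors_entry[OF assms(1), unfolded d]
  obtain e where e: "dims g = replicate k e"
    using assms(2) by (rule sym_tensors_dims)
  note g = sym_tensors_entry[OF assms(2), unfolded e]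
  have dims: "dims (tensor_sum f g) = replicate k (d + e)"
    by (rule nth_equalityI) (simp_all add: dims_tensor_sum d e)
  have E: "entry (tensor_sum f g) is = (if \<forall>l<k. is ! l < d then entry f is
      else if \<forall>l<k. d \<le> is ! l then entry g (map (\<lambda>l. is ! l - d) [0..<k]) else 0)"
    if "is \<in> indices (replicate k (d + e))" for "is"
  proof -
    have 1: "map (\<lambda>l. is ! l - dims f ! l) [0..<k] = map (\<lambda>l. is ! l - d) [0..<k]"
      by (simp add: d)
    have 2: "(\<forall>l<k. is ! l < dims f ! l) \<longleftrightarrow> (\<forall>l<k. is ! l < d)"
      "(\<forall>l<k. dims f ! l \<le> is ! l) \<longleftrightarrow> (\<forall>l<k. d \<le> is ! l)"
      by (simp_all add: d)
    have "length (dims f) = k" "length (dims g) = k" "is \<in> indices (dims (tensor_sum f g))"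
      using that by (simp_all add: d e dims)
    from entry_tensor_sum[OF this] show ?thesis unfolding 1 2 .
  qed
  show ?thesis
  proof (rule sym_tensorsI[OF dims])
    fix p "is" assume p: "p permutes {..<k}" and "is": "is \<in> indices (replicate k (d + e))"
    have l: "length is = k" using "is" by (simp add: indices_iff)
    have "(\<forall>l<k. permute_list p is ! l < d) \<longleftrightarrow> (\<forall>l<k. is ! l < d)"
      "(\<forall>l<k. d \<le> permute_list p is ! l) \<longleftrightarrow> (\<forall>l<k. d \<le> is ! l)"
      using all_permutes[OF p, of "\<lambda>l. is ! l < d"] all_permutes[OF p, of "\<lambda>l. d \<le> is ! l"]
      by (simp_all add: nth_permute_list[OF p l])
    moreover have "entry f (permute_list p is) = entry f is" if "\<forall>l<k. is ! l < d"
      using that l by (intro f p) (simp add: indices_iff)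
    moreover have "entry g (map (\<lambda>l. permute_list p is ! l - d) [0..<k]) = entry g (map (\<lambda>l. is ! l - d) [0..<k])"
      if "\<forall>l<k. d \<le> is ! l"
      unfolding map_permute_list[OF p l, of "\<lambda>i. i - d"]
      using that "is" by (intro g p) (simp add: indices_iff less_diff_conv2 add.commute)
    ultimately show "entry (tensor_sum f g) (permute_list p is) = entry (tensor_sum f g) is"
      unfolding E[OF "is"] E[OF permute_list_in_indices[OF p "is"]] by auto
  qed
qed

lemma tensor_prod_in_sym_tensors:
  fixes f g :: "'a::comm_semiring_1 tensor"
  assumes "f \<in> sym_tensors k" "g \<in> sym_tensors k"
  shows "tensor_prod f g \<in> sym_tensors k"
proof -
  obtain d where d: "dims f = replicate k d"
    using assms(1) by (rule sym_tensors_dims)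
  note f = sym_tensors_entry[OF assms(1), unfolded d]
  obtain e where e: "dims g = replicate k e"
    using assms(2) by (rule sym_tensors_dims)
  note g = sym_tensors_entry[OF assms(2), unfolded e]
  have dims: "dims (tensor_prod f g) = replicate k (d * e)"
    by (rule nth_equalityI) (simp_all add: dims_tensor_prod d e)
  have len: "length (dims f) = k" "length (dims g) = k" by (simp_all add: d e)
  have dm: "map (\<lambda>l. is ! l div e) [0..<k] \<in> indices (replicate k d)"
    "map (\<lambda>l. is ! l mod e) [0..<k] \<in> indices (replicate k e)"
    "entry (tensor_prod f g) is = entry f (map (\<lambda>l. is ! l div e) [0..<k]) * entry g (map (\<lambda>l. is ! l mod e) [0..<k])"
    if "is \<in> indices (replicate k (d * e))" for "is"
  proof -
    have 1: "map (\<lambda>l. is ! l div dims g ! l) [0..<k] = map (\<lambda>l. is ! l div e) [0..<k]"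
      "map (\<lambda>l. is ! l mod dims g ! l) [0..<k] = map (\<lambda>l. is ! l mod e) [0..<k]"
      by (simp_all add: e)
    have is': "is \<in> indices (dims (tensor_prod f g))" using that by (simp add: dims)
    show "map (\<lambda>l. is ! l div e) [0..<k] \<in> indices (replicate k d)"
      "map (\<lambda>l. is ! l mod e) [0..<k] \<in> indices (replicate k e)"
      using indices_div_mod[OF len is'] unfolding 1 unfolding d e .
    show "entry (tensor_prod f g) is = entry f (map (\<lambda>l. is ! l div e) [0..<k]) * entry g (map (\<lambda>l. is ! l mod e) [0..<k])"
      using entry_tensor_prod[OF len is'] unfolding 1 .
  qed
  show ?thesis
  proof (rule sym_tensorsI[OF dims])
    fix p "is" assume p: "p permutes {..<k}" and "is": "is \<in> indices (replicate k (d * e))"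
    have l: "length is = k" using "is" by (simp add: indices_iff)
    show "entry (tensor_prod f g) (permute_list p is) = entry (tensor_prod f g) is"
      unfolding dm(3)[OF "is"] dm(3)[OF permute_list_in_indices[OF p "is"]]
        map_permute_list[OF p l, of "\<lambda>i. i div e"] map_permute_list[OF p l, of "\<lambda>i. i mod e"]
      using f[OF p dm(1)[OF "is"]] g[OF p dm(2)[OF "is"]] by simp
  qed
qed

lemma unit_tensor_in_sym_tensors: "unit_tensor k \<in> sym_tensors k"
  by (rule sym_tensorsI[of _ _ 1]) (simp_all add: unit_tensor_def permute_list_in_indices)

lemma zero_tensor_in_sym_tensors: "zero_tensor k \<in> sym_tensors k"
  by (rule sym_tensorsI[of _ _ 0]) (simp_all add: zero_tensor_def permute_list_in_indices)

text \<open>The sum of \<open>e_p(0) \<otimes> ... \<otimes> e_p(k-1)\<close> over all permutations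
  p, that is, the coordinates of the permanent as a multilinear form in k vectors. It is the tensor
  of labels that turns restriction into symmetric restriction.\<close>

definition perm_tensor :: "nat \<Rightarrow> 'a::zero_neq_one tensor" where
  "perm_tensor k = tensor (replicate k k) (\<lambda>is. if distinct is then 1 else 0)"

lemma perm_tensor_in_sym_tensors: "perm_tensor k \<in> sym_tensors k"
proof (rule sym_tensorsI)
  show "dims (perm_tensor k) = replicate k k" by (simp add: perm_tensor_def)
  fix p "is" assume p: "p permutes {..<k}" and "is": "is \<in> indices (replicate k k)"
  then have "distinct (permute_list p is) \<longleftrightarrow> distinct is"
    by (intro distinct_permute_list) (simp add: indices_iff)
  then show "entry (perm_tensor k) (permute_list p is) = (entry (perm_tensor k) is :: 'a)"
    using "is" permute_list_in_indices[OF p "is"] by (simp add: perm_tensor_def)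
qed

lemma sum_distinct_indices:
  fixes F :: "nat list \<Rightarrow> 'a::comm_semiring_1"
  shows "(\<Sum>ls\<in>indices (replicate k k). (if distinct ls then 1 else 0) * F ls) =
    (\<Sum>p | p permutes {..<k}. F (map p [0..<k]))"
proof -
  have "(\<Sum>ls\<in>indices (replicate k k). (if distinct ls then 1 else 0) * F ls) =
      (\<Sum>ls\<in>{ls \<in> indices (replicate k k). distinct ls}. F ls)"
    by (rule sum.mono_neutral_cong_right) (auto simp: finite_indices)
  also have "\<dots> = (\<Sum>p | p permutes {..<k}. F (map p [0..<k]))"
  \<comment> \<open>A list is extended to a function by the identity beyond \<open>k\<close>, as
    \<open>permutes\<close> demands.\<close>
  proof (rule sum.reindex_bij_witness[where i = "\<lambda>p. map p [0..<k]" and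
        j = "\<lambda>ls l. if l < k then ls ! l else l"])
    fix ls assume ls: "ls \<in> {ls \<in> indices (replicate k k). distinct ls}"
    then have len: "length ls = k" and lt: "\<And>l. l < k \<Longrightarrow> ls ! l < k" and dist: "distinct ls"
      by (auto simp: indices_iff)
    show eq: "map (\<lambda>l. if l < k then ls ! l else l) [0..<k] = ls"
      by (rule nth_equalityI) (simp_all add: len)
    then show "F (map (\<lambda>l. if l < k then ls ! l else l) [0..<k]) = F ls" by simp
    have inj: "inj_on (\<lambda>l. if l < k then ls ! l else l) {..<k}"
      using dist len by (auto simp: inj_on_def nth_eq_iff_index_eq)
    moreover have "(\<lambda>l. if l < k then ls ! l else l) ` {..<k} \<subseteq> {..<k}"
      using lt by auto
    ultimately have "(\<lambda>l. if l < k then ls ! l else l) ` {..<k} = {..<k}"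
      by (intro endo_inj_surj finite_lessThan)
    with inj have "bij_betw (\<lambda>l. if l < k then ls ! l else l) {..<k} {..<k}"
      by (simp add: bij_betw_def)
    then have "(\<lambda>l. if l < k then ls ! l else l) permutes {..<k}"
      by (rule bij_imp_permutes) simp
    then show "(\<lambda>l. if l < k then ls ! l else l) \<in> {p. p permutes {..<k}}" by simp
  next
    fix p assume "p \<in> {p. p permutes {..<k}}"
    then have p: "p permutes {..<k}" by simp
    show "(\<lambda>l. if l < k then map p [0..<k] ! l else l) = p"
      using p by (auto simp: fun_eq_iff permutes_def)
    show "map p [0..<k] \<in> {ls \<in> indices (replicate k k). distinct ls}"
      using p by (auto simp: indices_iff permutes_less distinct_map permutes_inj_on)
  qed
  finally show ?thesis .
qed

lemma sum_permute_indices: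
  fixes F :: "nat list \<Rightarrow> 'a::comm_monoid_add"
  assumes p: "p permutes {..<k}"
  shows "(\<Sum>ms\<in>indices (replicate k e). F (permute_list p ms)) = (\<Sum>ms\<in>indices (replicate k e). F ms)"
proof (rule sum.reindex_bij_witness[where i = "permute_list (inv_into UNIV p)" and j = "permute_list p"])
  note ip = permutes_inv[OF p]
  fix ms assume ms: "ms \<in> indices (replicate k e)"
  then have l: "length ms = k" by (simp add: indices_iff)
  show "permute_list (inv_into UNIV p) (permute_list p ms) = ms"
    using permute_list_compose[of "inv_into UNIV p" ms p] ip l permutes_inv_o[OF p] by simp
  show "permute_list p (permute_list (inv_into UNIV p) ms) = ms"
    using permute_list_compose[of p ms "inv_into UNIV p"] p l permutes_inv_o[OF p] by simp
qed (use p in \<open>simp_all add: permute_list_in_indices permutes_inv\<close>)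

text \<open>
  If \<open>f = (A\<^sub>1 \<otimes> \<dots> \<otimes> A\<^sub>k) g\<close> with \<open>f\<close> and \<open>g\<close> symmetric, then averaging over the symmetric group
  gives \<open>k! f = \<Sum>\<^sub>p (A\<^bsub>p 1\<^esub> \<otimes> \<dots> \<otimes> A\<^bsub>p k\<^esub>) g\<close>, and the right-hand side is the image of
  \<open>perm_tensor k \<otimes> g\<close> under the \<open>k\<close>-th power of the single map \<open>e\<^sub>i \<otimes> v \<mapsto> A\<^sub>i v\<close>.
\<close>

lemma sym_restricts_perm_tensor:
  fixes f g :: "'a::comm_semiring_1 tensor"
    and c :: 'a
  assumes f: "f \<in> sym_tensors k" and g: "g \<in> sym_tensors k" and fg: "restricts f g"
    and c: "c ^ k * of_nat (fact k) = 1"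
  shows "sym_restricts f (tensor_prod (perm_tensor k) g)"
proof -
  obtain d where d: "dims f = replicate k d"
    using f by (rule sym_tensors_dims)
  note fp = sym_tensors_entry[OF f, unfolded d]
  obtain e where e: "dims g = replicate k e"
    using g by (rule sym_tensors_dims)
  note gp = sym_tensors_entry[OF g, unfolded e]
  obtain a where a: "\<And>is. is \<in> indices (replicate k d) \<Longrightarrow>
      entry f is = (\<Sum>js\<in>indices (replicate k e). (\<Prod>l<k. a l (is ! l) (js ! l)) * entry g js)"
    using fg by (auto simp: restricts_iff d e)
  define h :: "'a tensor" where "h = perm_tensor k"
  have h: "dims h = replicate k k" "\<And>is. is \<in> indices (replicate k k) \<Longrightarrow> entry h is = (if distinct is then 1 else 0)"
    by (simp_all add: h_def perm_tensor_def)
  have len: "length (dims h) = k" "length (dims g) = k" by (simp_all add: h e)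
  have dims: "dims (tensor_prod h g) = replicate k (k * e)"
    by (rule nth_equalityI) (simp_all add: dims_tensor_prod h e)
  \<comment> \<open>A column \<open>j\<close> encodes a label \<open>j div e\<close>, which selects
    one of the given maps, and a basis vector \<open>j mod e\<close>, to which that map is applied.
    The same matrix acts in all k factors, so its scalar enters as \<open>c ^ k\<close>, which must
    be 1 / k!.\<close>
  define A where "A = mat d (k * e) (\<lambda>(i, j). c * a (j div e) i (j mod e))"
  \<comment> \<open>The given maps may be distributed over the factors in any order: the change is
    absorbed on one side by the symmetry of \<open>f\<close>, on the other by that of
    \<open>g\<close> after reindexing the sum.\<close>
  have perm: "(\<Sum>ms\<in>indices (replicate k e). (\<Prod>m<k. a (p m) (is ! m) (ms ! m)) * entry g ms) = entry f is"
    if p: "p permutes {..<k}" and "is": "is \<in> indices (replicate k d)" for p "is"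
  proof -
    define q where "q = inv_into UNIV p"
    have q: "q permutes {..<k}" unfolding q_def by (rule permutes_inv[OF p])
    have lis: "length is = k" using "is" by (simp add: indices_iff)
    have "entry f is = entry f (permute_list q is)"
      using fp[OF q "is"] by simp
    also have "\<dots> = (\<Sum>ms\<in>indices (replicate k e). (\<Prod>l<k. a l (permute_list q is ! l) (ms ! l)) * entry g ms)"
      by (rule a[OF permute_list_in_indices[OF q "is"]])
    also have "\<dots> = (\<Sum>ms\<in>indices (replicate k e).
        (\<Prod>l<k. a l (permute_list q is ! l) (permute_list q ms ! l)) * entry g (permute_list q ms))"
      using sum_permute_indices[OF q, of "\<lambda>ms. (\<Prod>l<k. a l (permute_list q is ! l) (ms ! l)) * entry g ms" e]
      by simp
    also have "\<dots> = (\<Sum>ms\<in>indices (replicate k e). (\<Prod>m<k. a (p m) (is ! m) (ms ! m)) * entry g ms)"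
    proof (intro sum.cong refl arg_cong2[where f = "(*)"])
      fix ms assume ms: "ms \<in> indices (replicate k e)"
      then have lms: "length ms = k" by (simp add: indices_iff)
      show "entry g (permute_list q ms) = entry g ms" by (rule gp[OF q ms])
      have "(\<Prod>l<k. a l (permute_list q is ! l) (permute_list q ms ! l)) = (\<Prod>l<k. a l (is ! q l) (ms ! q l))"
        by (intro prod.cong refl) (simp add: nth_permute_list[OF q] lis lms)
      also have "\<dots> = (\<Prod>l<k. a (p (q l)) (is ! q l) (ms ! q l))"
        by (simp add: q_def permutes_inverses[OF p])
      also have "\<dots> = (\<Prod>m<k. a (p m) (is ! m) (ms ! m))"
        using prod.permute[OF q, of "\<lambda>m. a (p m) (is ! m) (ms ! m)"] by (simp add: o_def)
      finally show "(\<Prod>l<k. a l (permute_list q is ! l) (permute_list q ms ! l)) = (\<Prod>m<k. a (p m) (is ! m) (ms ! m))" .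
    qed
    finally show ?thesis by simp
  qed
  have entries: "entry f is = (\<Sum>js\<in>indices (dims (tensor_prod h g)).
      (\<Prod>l<k. A $$ (is ! l, js ! l)) * entry (tensor_prod h g) js)" if "is": "is \<in> indices (replicate k d)" for "is"
  proof -
    have lis: "\<And>l. l < k \<Longrightarrow> is ! l < d" using "is" by (simp add: indices_iff)
    have "(\<Sum>js\<in>indices (dims (tensor_prod h g)). (\<Prod>l<k. A $$ (is ! l, js ! l)) * entry (tensor_prod h g) js)
      = (\<Sum>ls\<in>indices (dims h). \<Sum>ms\<in>indices (dims g).
          (\<Prod>l<k. A $$ (is ! l, map (\<lambda>l. ls ! l * dims g ! l + ms ! l) [0..<k] ! l))
          * entry (tensor_prod h g) (map (\<lambda>l. ls ! l * dims g ! l + ms ! l) [0..<k]))"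
      unfolding dims_tensor_prod by (rule sum_indices_mult[OF len])
    also have "\<dots> = (\<Sum>ls\<in>indices (replicate k k). \<Sum>ms\<in>indices (replicate k e).
        (c ^ k * (\<Prod>l<k. a (ls ! l) (is ! l) (ms ! l))) * ((if distinct ls then 1 else 0) * entry g ms))"
      unfolding h(1) e
    proof (intro sum.cong refl arg_cong2[where f = "(*)"])
      fix ls ms assume ls: "ls \<in> indices (replicate k k)" and ms: "ms \<in> indices (replicate k e)"
      have "A $$ (is ! l, ls ! l * e + ms ! l) = c * a (ls ! l) (is ! l) (ms ! l)" if l: "l < k" for l
      proof -
        have "ls ! l < k" "ms ! l < e" using ls ms l by (simp_all add: indices_iff)
        then show ?thesis
          using lis[OF l] mult_add_less[of "ls ! l" k "ms ! l" e] by (simp add: A_def mult_add_div_mod)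
      qed
      then have "(\<Prod>l<k. A $$ (is ! l, map (\<lambda>l. ls ! l * replicate k e ! l + ms ! l) [0..<k] ! l))
          = (\<Prod>l<k. c * a (ls ! l) (is ! l) (ms ! l))"
        by (intro prod.cong) auto
      then show "(\<Prod>l<k. A $$ (is ! l, map (\<lambda>l. ls ! l * replicate k e ! l + ms ! l) [0..<k] ! l))
          = c ^ k * (\<Prod>l<k. a (ls ! l) (is ! l) (ms ! l))"
        by (simp add: prod.distrib)
      show "entry (tensor_prod h g) (map (\<lambda>l. ls ! l * replicate k e ! l + ms ! l) [0..<k])
          = (if distinct ls then 1 else 0) * entry g ms"
        using entry_tensor_prod_index[OF len, of ls ms] ls ms h by (simp add: e)
    qed
    \<comment> \<open>The sum over labels is moved outside. The entry of \<open>perm_tensor\<close>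
      discards label lists with repetitions, which leaves one term for each permutation, and by
      \<open>perm\<close> every such term is \<open>c ^ k * entry f is\<close>.\<close>
    also have "\<dots> = (\<Sum>ls\<in>indices (replicate k k). (if distinct ls then 1 else 0) *
        (c ^ k * (\<Sum>ms\<in>indices (replicate k e). (\<Prod>l<k. a (ls ! l) (is ! l) (ms ! l)) * entry g ms)))"
      by (intro sum.cong refl) (simp add: sum_distrib_left mult_ac)
    also have "\<dots> = (\<Sum>p | p permutes {..<k}. c ^ k *
        (\<Sum>ms\<in>indices (replicate k e). (\<Prod>l<k. a (map p [0..<k] ! l) (is ! l) (ms ! l)) * entry g ms))"
      by (rule sum_distinct_indices)
    also have "\<dots> = (\<Sum>p | p permutes {..<k}. c ^ k * entry f is)"
    proof (intro sum.cong refl arg_cong2[where f = "(*)"])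
      fix p assume "p \<in> {p. p permutes {..<k}}"
      then have p: "p permutes {..<k}" by simp
      have "(\<Sum>ms\<in>indices (replicate k e). (\<Prod>l<k. a (map p [0..<k] ! l) (is ! l) (ms ! l)) * entry g ms)
        = (\<Sum>ms\<in>indices (replicate k e). (\<Prod>l<k. a (p l) (is ! l) (ms ! l)) * entry g ms)"
        by (intro sum.cong refl arg_cong2[where f = "(*)"] prod.cong) auto
      then show "(\<Sum>ms\<in>indices (replicate k e). (\<Prod>l<k. a (map p [0..<k] ! l) (is ! l) (ms ! l)) * entry g ms)
          = entry f is"
        using perm[OF p "is"] by simp
    qed
    also have "\<dots> = of_nat (fact k) * (c ^ k * entry f is)"
      using card_permutations[of "{..<k}" k] by simp
    also have "\<dots> = (c ^ k * of_nat (fact k)) * entry f is"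
      by (simp only: mult_ac)
    also have "\<dots> = entry f is"
      unfolding c by simp
    finally show ?thesis by simp
  qed
  have "f = tensor_apply (replicate k A) (tensor_prod h g)"
  proof (rule tensor_eqI)
    show dims': "dims f = dims (tensor_apply (replicate k A) (tensor_prod h g))"
      by (simp add: tensor_apply_def d A_def)
    fix "is" assume "is \<in> indices (dims (tensor_apply (replicate k A) (tensor_prod h g)))"
    then have "is": "is \<in> indices (replicate k d)" using dims' d by simp
    moreover have "(\<Prod>l<k. replicate k A ! l $$ (is ! l, js ! l)) = (\<Prod>l<k. A $$ (is ! l, js ! l))" for js
      by (intro prod.cong) auto
    ultimately show "entry f is = entry (tensor_apply (replicate k A) (tensor_prod h g)) is"
      using entries[OF "is"] by (simp add: tensor_apply_def A_def)
  qed
  then show ?thesis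
    unfolding sym_restricts_def Let_def h_def[symmetric] dims
    by (intro exI[of _ A]) (simp add: A_def)
qed

text \<open>A positive characteristic is here a prime exceeding \<open>k\<close>, so it divides no
  factor of k!.\<close>

lemma of_nat_fact_neq_0:
  assumes "CHAR('a::idom) = 0 \<or> CHAR('a) \<ge> k + 1"
  shows "of_nat (fact k) \<noteq> (0 :: 'a)"
proof (cases "CHAR('a) = 0")
  case True
  then show ?thesis by (simp add: of_nat_eq_0_iff_char_dvd del: of_nat_fact)
next
  case False
  then have "prime CHAR('a)" by (intro prime_CHAR_semidom) simp
  moreover have "k < CHAR('a)" using assms False by simp
  ultimately show ?thesis
    by (simp add: of_nat_eq_0_iff_char_dvd prime_dvd_fact_iff del: of_nat_fact)
qed

lemma sym_restricts_imp_restricts: "sym_restricts g f \<Longrightarrow> restricts g f"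
  unfolding sym_restricts_def restricts_def Let_def by blast

text \<open>Otherwise the powers of \<open>x / y\<close> would outgrow \<open>C\<close>; for
  \<open>y = 0\<close> the exponent 1 already decides.\<close>

lemma le_of_power_le:
  fixes x y C :: real
  assumes x: "0 \<le> x" and y: "0 \<le> y" and le: "\<And>n. x ^ n \<le> C * y ^ n"
  shows "x \<le> y"
proof (cases "y = 0")
  case True
  then show ?thesis using le[of 1] by simp
next
  case False
  then have y: "y > 0" using y by simp
  show ?thesis
  proof (rule ccontr)
    assume "\<not> ?thesis"
    then have "1 < x / y" using y by simp
    then obtain n where "C < (x / y) ^ n" using real_arch_pow by blast
    then have "C * y ^ n < x ^ n" using y by (simp add: power_divide field_simps)
    then show False using le[of n] by simp
  qed
qed

section \<open>Points of the symmetric asymptotic spectrum\<close>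

context
  fixes k :: nat and \<phi> :: "'a::alg_closed_field tensor \<Rightarrow> real"
  assumes k: "k > 0" and char: "CHAR('a) = 0 \<or> CHAR('a) \<ge> k + 1"
    and \<phi>: "\<phi> \<in> sym_asymptotic_spectrum k"
begin

lemma
  shows spectrum_nonneg: "f \<in> sym_tensors k \<Longrightarrow> 0 \<le> \<phi> f"
    and spectrum_sum: "f \<in> sym_tensors k \<Longrightarrow> g \<in> sym_tensors k \<Longrightarrow> \<phi> (tensor_sum f g) = \<phi> f + \<phi> g"
    and spectrum_prod: "f \<in> sym_tensors k \<Longrightarrow> g \<in> sym_tensors k \<Longrightarrow> \<phi> (tensor_prod f g) = \<phi> f * \<phi> g"
    and spectrum_unit: "\<phi> (unit_tensor k) = 1"
    and spectrum_mono: "f \<in> sym_tensors k \<Longrightarrow> g \<in> sym_tensors k \<Longrightarrow> sym_restricts g f \<Longrightarrow> \<phi> g \<le> \<phi> f"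
    and spectrum_ext: "\<phi> \<in> extensional (sym_tensors k)"
  using \<phi> by (auto simp: sym_asymptotic_spectrum_def PiE_def Pi_def)

lemma spectrum_mono_perm_tensor:
  assumes "f \<in> sym_tensors k" "g \<in> sym_tensors k" "restricts f g"
  shows "\<phi> f \<le> \<phi> (perm_tensor k) * \<phi> g"
proof -
  have "of_nat (fact k) \<noteq> (0 :: 'a)" using char by (rule of_nat_fact_neq_0)
  \<comment> \<open>Here algebraic closedness enters: the scalar of a single map is raised to the
    k-th power, so inverting k! is not enough and a k-th root of the inverse is taken.\<close>
  moreover obtain r :: 'a where "r ^ k = inverse (of_nat (fact k))"
    using nth_root_exists[OF k] by blast
  ultimately have "r ^ k * of_nat (fact k) = 1" by simp
  then have "sym_restricts f (tensor_prod (perm_tensor k) g)"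
    using assms by (intro sym_restricts_perm_tensor)
  then have "\<phi> f \<le> \<phi> (tensor_prod (perm_tensor k) g)"
    using assms by (intro spectrum_mono tensor_prod_in_sym_tensors perm_tensor_in_sym_tensors)
  then show ?thesis
    using assms by (simp add: spectrum_prod perm_tensor_in_sym_tensors)
qed

text \<open>The constant \<open>\<phi> (perm_tensor k)\<close> is removed by passing to tensor powers.\<close>

lemma spectrum_mono_restricts:
  assumes f: "f \<in> sym_tensors k" and g: "g \<in> sym_tensors k" and fg: "restricts f g"
  shows "\<phi> f \<le> \<phi> g"
proof (rule le_of_power_le)
  define pow :: "'a tensor \<Rightarrow> nat \<Rightarrow> 'a tensor"
    where "pow f = rec_nat (unit_tensor k) (\<lambda>_. tensor_prod f)" for f
  have pow_0: "pow f 0 = unit_tensor k" and pow_Suc: "pow f (Suc n) = tensor_prod f (pow f n)" for f n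
    by (simp_all add: pow_def)
  have pow_sym: "pow f n \<in> sym_tensors k" if "f \<in> sym_tensors k" for f n
    by (induction n) (simp_all add: pow_0 pow_Suc unit_tensor_in_sym_tensors tensor_prod_in_sym_tensors that)
  have pow_\<phi>: "\<phi> (pow f n) = \<phi> f ^ n" if "f \<in> sym_tensors k" for f n
    by (induction n) (simp_all add: pow_0 pow_Suc spectrum_unit spectrum_prod pow_sym that)
  have "restricts (pow f n) (pow g n)" for n
  proof (induction n)
    case 0
    show ?case by (simp add: pow_0 restricts_refl)
  next
    case (Suc n)
    then show ?case
      unfolding pow_Suc using fg f g
      by (intro restricts_tensor_prod[where k = k]) (auto intro: sym_tensors_subset pow_sym)
  qed
  then show "\<phi> f ^ n \<le> \<phi> (perm_tensor k) * \<phi> g ^ n" for n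
    using spectrum_mono_perm_tensor[OF pow_sym[OF f] pow_sym[OF g]] by (simp add: pow_\<phi> f g)
qed (use f g in \<open>simp_all add: spectrum_nonneg\<close>)

text \<open>Mutual restriction takes the place of equality because the represented elements must
  form a subsemiring containing 1, and 1 differs from the image of
  \<open>unit_tensor k\<close>.\<close>

definition represents :: "'a tensor \<Rightarrow> 'a tensor_family \<Rightarrow> bool" where
  "represents f x \<longleftrightarrow> f \<in> sym_tensors k \<and> restricts_at k x (embed k f) \<and> restricts_at k (embed k f) x"

lemma represents_embed: "f \<in> sym_tensors k \<Longrightarrow> represents f (embed k f)"
  by (simp add: represents_def restricts_at_embed k sym_tensors_subset restricts_refl)

lemma sym_spectrum_extends: "\<phi> \<in> (\<lambda>\<psi>. restrict \<psi> (sym_tensors k)) ` asymptotic_spectrum k"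
proof -
  interpret P: semiring_preorder "restricts_at k :: 'a tensor_family \<Rightarrow> _"
    using k by (rule semiring_preorder_restricts_at)
  define S where "S = {x. \<exists>f. represents f x}"
  define \<phi>' where "\<phi>' x = \<phi> (SOME f. represents f x)" for x
  \<comment> \<open>The preorder \<open>restricts_at k\<close> only knows restriction by k
    independent maps, which is why monotonicity under symmetric restriction had to be strengthened
    beforehand.\<close>
  have mono: "\<phi> f \<le> \<phi> g" if "represents f x" "represents g y" "restricts_at k x y" for f g x y
  proof -
    have "restricts_at k (embed k f) (embed k g)"
      using that unfolding represents_def by (meson P.le_trans)
    then show ?thesis
      using that by (intro spectrum_mono_restricts) (auto simp: represents_def restricts_at_embed k sym_tensors_subset)
  qed
  \<comment> \<open>Two representatives of one element restrict to each other, so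
    \<open>mono\<close> in both directions makes the choice immaterial.\<close>
  have \<phi>': "\<phi>' x = \<phi> f" if "represents f x" for f x
  proof -
    have "represents (SOME f. represents f x) x" using that by (rule someI)
    then show ?thesis
      unfolding \<phi>'_def using that P.le_refl by (intro antisym mono)
  qed
  have rep_sum: "represents (tensor_sum f g) (x + y)" if "represents f x" "represents g y" for f g x y
    using that unfolding represents_def
    by (auto simp: embed_sum sym_tensors_subset tensor_sum_in_sym_tensors intro: P.le_add_mono)
  have rep_prod: "represents (tensor_prod f g) (x * y)" if "represents f x" "represents g y" for f g x y
    using that unfolding represents_def
    by (auto simp: embed_prod sym_tensors_subset tensor_prod_in_sym_tensors intro: P.le_mult_mono)
  have rep_0: "represents (zero_tensor k) 0"
    by (simp add: represents_def zero_tensor_in_sym_tensors embed_zero P.le_refl)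
  have rep_1: "represents (unit_tensor k) 1"
    by (simp add: represents_def unit_tensor_in_sym_tensors restricts_at_embed_unit k)
  interpret subsemiring_point "restricts_at k" S \<phi>'
  proof
    show "0 \<in> S" "1 \<in> S" using rep_0 rep_1 by (auto simp: S_def)
    show "\<phi>' 1 = 1" using \<phi>'[OF rep_1] by (simp add: spectrum_unit)
    fix x y assume "x \<in> S" "y \<in> S"
    then obtain f g where f: "represents f x" and g: "represents g y" by (auto simp: S_def)
    then have sym: "f \<in> sym_tensors k" "g \<in> sym_tensors k" by (auto simp: represents_def)
    show "x + y \<in> S" "x * y \<in> S" using rep_sum[OF f g] rep_prod[OF f g] by (auto simp: S_def)
    show "\<phi>' (x + y) = \<phi>' x + \<phi>' y" "\<phi>' (x * y) = \<phi>' x * \<phi>' y"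
      using \<phi>'[OF f] \<phi>'[OF g] \<phi>'[OF rep_sum[OF f g]] \<phi>'[OF rep_prod[OF f g]] sym
      by (simp_all add: spectrum_sum spectrum_prod)
    show "\<phi>' x \<le> \<phi>' y" if "restricts_at k x y"
      using mono[OF f g that] \<phi>'[OF f] \<phi>'[OF g] by simp
  qed
  obtain \<psi> where \<psi>: "\<And>x y. \<psi> (x + y) = \<psi> x + \<psi> y" "\<And>x y. \<psi> (x * y) = \<psi> x * \<psi> y"
    "\<And>x. 0 \<le> \<psi> x" "\<And>x y. restricts_at k x y \<Longrightarrow> \<psi> x \<le> \<psi> y" "\<And>s. s \<in> S \<Longrightarrow> \<psi> s = \<phi>' s"
    using extension by blast
  define \<Psi> where "\<Psi> = restrict (\<lambda>f. \<psi> (embed k f)) (tensors k)"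
  have \<Psi>_sym: "\<Psi> f = \<phi> f" if "f \<in> sym_tensors k" for f
  proof -
    have "\<psi> (embed k f) = \<phi>' (embed k f)"
      using represents_embed[OF that] by (intro \<psi>(5)) (auto simp: S_def)
    then show ?thesis
      using \<phi>'[OF represents_embed[OF that]] that by (simp add: \<Psi>_def sym_tensors_subset)
  qed
  have "\<Psi> \<in> asymptotic_spectrum k"
    unfolding asymptotic_spectrum_def
  proof (intro CollectI conjI ballI impI)
    show "\<Psi> \<in> tensors k \<rightarrow>\<^sub>E {0..}" using \<psi>(3) by (auto simp: \<Psi>_def)
    \<comment> \<open>The normalization is inherited from \<open>\<phi>\<close>, the unit tensor
      being symmetric.\<close>
    show "\<Psi> (unit_tensor k) = 1"
      by (simp add: \<Psi>_sym unit_tensor_in_sym_tensors spectrum_unit)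
    fix f g :: "'a tensor" assume fg: "f \<in> tensors k" "g \<in> tensors k"
    show "\<Psi> (tensor_sum f g) = \<Psi> f + \<Psi> g" "\<Psi> (tensor_prod f g) = \<Psi> f * \<Psi> g"
      using fg by (simp_all add: \<Psi>_def tensor_closure embed_sum embed_prod \<psi>(1,2))
    show "\<Psi> g \<le> \<Psi> f" if "restricts g f"
      using fg that by (simp add: \<Psi>_def \<psi>(4) restricts_at_embed k)
  qed
  moreover have "\<phi> = restrict \<Psi> (sym_tensors k)"
    using spectrum_ext by (intro extensionalityI[of _ "sym_tensors k"]) (auto simp: \<Psi>_sym)
  ultimately show ?thesis by blast
qed

end

theorem theorem4p2:
  fixes k :: nat
  assumes "k \<ge> 2"
    and "CHAR('a::alg_closed_field) = 0 \<or> CHAR('a) \<ge> k + 1"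
  shows "(\<lambda>\<phi>. restrict \<phi> (sym_tensors k)) ` asymptotic_spectrum k =
    (sym_asymptotic_spectrum k :: ('a tensor \<Rightarrow> real) set)"
proof (rule antisym)
  \<comment> \<open>Surjectivity is phrased as an equality of sets. This half says that the
    restriction map does land in the symmetric spectrum, since symmetric restriction is a special
    case of restriction.\<close>
  show "(\<lambda>\<phi>. restrict \<phi> (sym_tensors k)) ` asymptotic_spectrum k \<subseteq>
    (sym_asymptotic_spectrum k :: ('a tensor \<Rightarrow> real) set)"
  proof
    fix \<psi> :: "'a tensor \<Rightarrow> real"
    assume "\<psi> \<in> (\<lambda>\<phi>. restrict \<phi> (sym_tensors k)) ` asymptotic_spectrum k"
    then obtain \<phi> where "\<phi> \<in> asymptotic_spectrum k" "\<psi> = restrict \<phi> (sym_tensors k)" by blast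
    then show "\<psi> \<in> sym_asymptotic_spectrum k"
      by (simp add: asymptotic_spectrum_def sym_asymptotic_spectrum_def PiE_def Pi_def sym_tensors_subset
          tensor_sum_in_sym_tensors tensor_prod_in_sym_tensors unit_tensor_in_sym_tensors
          sym_restricts_imp_restricts)
  qed
  show "(sym_asymptotic_spectrum k :: ('a tensor \<Rightarrow> real) set) \<subseteq>
      (\<lambda>\<phi>. restrict \<phi> (sym_tensors k)) ` asymptotic_spectrum k"
    using assms by (auto intro: sym_spectrum_extends)
qed

end
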